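(* Let $V=\frac{\partial}{\partial x^3}$ and $\eta=dx^3$, and let $\lambda,\mu$ be smooth functions on $I$ with $\mu$ not identically zero. If $f_1=f_1(x^1)$ depends only on $x^1$ and $f_2=f_2(x^3)$ depends only on $x^3$, then $(I,\tilde g,V,\lambda,\mu)$ is an almost $\eta$-Ricci soliton if and only if either $$f_2(x^3)=c_0e^{-x^3},\quad \lambda=0,\quad \mu=1,$$ for some $c_0\in\mathbb R\setminus\{0\}$, or $$f_2(x^3)=\frac{c_1}{c_2e^{x^3}+1},\quad \lambda=0,\quad \mu(x^3)=\frac{c_2e^{x^3}}{c_2e^{x^3}+1},$$ for some $c_1,c_2\in\mathbb R\setminus\{0\}$ such that $c_2\neq-e^{-x^3}$ for all $x^3\in I_3$. In particular, for $I_3=\mathbb R$, in the second alternative one additionally has $c_2>0$.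
   Context: Let $I=I_1\times I_2\times I_3\subseteq\mathbb R^3$ with $I_1,I_2,I_3\subseteq\mathbb R$ open intervals and standard coordinates $x^1,x^2,x^3$. Let $f_1,f_2$ be smooth nowhere zero functions on $I$ and endow $I$ with the Riemannian metric $\tilde g=\frac{1}{f_1^2}dx^1\otimes dx^1+\frac{1}{f_2^2}dx^2\otimes dx^2+dx^3\otimes dx^3$, with orthonormal frame $E_1=f_1\frac{\partial}{\partial x^1}$, $E_2=f_2\frac{\partial}{\partial x^2}$, $E_3=\frac{\partial}{\partial x^3}$. For a smooth vector field $V$, a $1$-form $\eta$, and smooth functions $\lambda,\mu$ on $I$ with $\mu\neq0$ (not identically zero), $(I,\tilde g,V,\lambda,\mu)$ is an almost $\eta$-Ricci soliton if $\frac12\pounds_V\tilde g+\mathrm{Ric}+\lambda\tilde g+\mu\,\eta\otimes\eta=0$ on $I$, where $\pounds_V\tilde g$ is the Lie derivative of $\tilde g$ along $V$ and $\mathrm{Ric}$ is the Ricci tensor of $\tilde g$, with $\mathrm{Ric}(Y,Z)=\sum_{k}\tilde g(R(E_k,Y)Z,E_k)$, $R(X,Y)Z=\nabla_X\nabla_YZ-\nabla_Y\nabla_XZ-\nabla_{[X,Y]}Z$, $\nabla$ the Levi-Civita connection. *)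

theory Defs
  imports "HOL-Analysis.Analysis"
begin

text \<open>
  Riemannian geometry on an open set \<open>U\<close> of \<open>real ^ 'n\<close>, written in the global standard coordinates.
  Functions, vector fields and tensors are total functions of the base point, but only their
  values on \<open>U\<close> are meaningful; all conditions and equations are imposed at points of \<open>U\<close> only.
\<close>

type_synonym 'n vfield = "real ^ 'n \<Rightarrow> real ^ 'n"
type_synonym 'n oneform = "real ^ 'n \<Rightarrow> real ^ 'n \<Rightarrow> real"
type_synonym 'n tensor2 = "real ^ 'n \<Rightarrow> real ^ 'n \<Rightarrow> real ^ 'n \<Rightarrow> real"
type_synonym 'n connection = "'n vfield \<Rightarrow> 'n vfield \<Rightarrow> 'n vfield"

definition partial :: "'n::finite \<Rightarrow> (real ^ 'n \<Rightarrow> 'b::real_normed_vector) \<Rightarrow> real ^ 'n \<Rightarrow> 'b" where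
  "partial i f = (\<lambda>x. frechet_derivative f (at x) (axis i 1))"

text \<open>For open \<open>U\<close> this is the class of C-infinity maps: if every iterated partial derivative is
  differentiable on \<open>U\<close>, then every iterated partial derivative is also continuous on \<open>U\<close>.\<close>

definition smooth_on :: "(real ^ 'n) set \<Rightarrow> (real ^ 'n::finite \<Rightarrow> 'b::real_normed_vector) \<Rightarrow> bool" where
  "smooth_on U f \<longleftrightarrow> (\<forall>is. \<forall>x\<in>U. foldr partial is f differentiable (at x))"

definition vderiv :: "'n::finite vfield \<Rightarrow> (real ^ 'n \<Rightarrow> real) \<Rightarrow> real ^ 'n \<Rightarrow> real" where
  "vderiv X f = (\<lambda>x. frechet_derivative f (at x) (X x))"

definition lie_bracket :: "'n::finite vfield \<Rightarrow> 'n vfield \<Rightarrow> 'n vfield" where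
  "lie_bracket X Y =
    (\<lambda>x. frechet_derivative Y (at x) (X x) - frechet_derivative X (at x) (Y x))"

definition coord_field :: "'n::finite \<Rightarrow> 'n vfield" where
  "coord_field i = (\<lambda>x. axis i 1)"

definition coord_form :: "'n::finite \<Rightarrow> 'n oneform" where
  "coord_form i = (\<lambda>x v. v $ i)"

definition tensor_prod :: "'n::finite oneform \<Rightarrow> 'n oneform \<Rightarrow> 'n tensor2" where
  "tensor_prod \<alpha> \<beta> = (\<lambda>x u v. \<alpha> x u * \<beta> x v)"

definition smooth_one_form :: "(real ^ 'n) set \<Rightarrow> 'n::finite oneform \<Rightarrow> bool" where
  "smooth_one_form U \<eta> \<longleftrightarrow>
    (\<forall>x\<in>U. linear (\<eta> x)) \<and> (\<forall>i. smooth_on U (\<lambda>x. \<eta> x (axis i 1)))"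

definition riemannian_metric :: "(real ^ 'n) set \<Rightarrow> 'n::finite tensor2 \<Rightarrow> bool" where
  "riemannian_metric U g \<longleftrightarrow>
    open U \<and>
    (\<forall>x\<in>U. bilinear (g x) \<and> (\<forall>u v. g x u v = g x v u) \<and> (\<forall>u. u \<noteq> 0 \<longrightarrow> g x u u > 0)) \<and>
    (\<forall>i j. smooth_on U (\<lambda>x. g x (axis i 1) (axis j 1)))"

definition orthonormal_frame ::
    "(real ^ 'n) set \<Rightarrow> 'n::finite tensor2 \<Rightarrow> ('n \<Rightarrow> 'n vfield) \<Rightarrow> bool" where
  "orthonormal_frame U g E \<longleftrightarrow>
    (\<forall>k. smooth_on U (E k)) \<and>
    (\<forall>x\<in>U. \<forall>j k. g x (E j x) (E k x) = (if j = k then 1 else 0))"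

text \<open>\<open>D X Y\<close> is the covariant derivative of \<open>Y\<close> along \<open>X\<close>.\<close>

definition affine_connection :: "(real ^ 'n) set \<Rightarrow> 'n::finite connection \<Rightarrow> bool" where
  "affine_connection U D \<longleftrightarrow>
    (\<forall>X Y. smooth_on U X \<longrightarrow> smooth_on U Y \<longrightarrow> smooth_on U (D X Y)) \<and>
    (\<forall>X X' Y. smooth_on U X \<longrightarrow> smooth_on U X' \<longrightarrow> smooth_on U Y \<longrightarrow>
      (\<forall>x\<in>U. D (\<lambda>y. X y + X' y) Y x = D X Y x + D X' Y x)) \<and>
    (\<forall>f X Y. smooth_on U f \<longrightarrow> smooth_on U X \<longrightarrow> smooth_on U Y \<longrightarrow>
      (\<forall>x\<in>U. D (\<lambda>y. f y *\<^sub>R X y) Y x = f x *\<^sub>R D X Y x)) \<and>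
    (\<forall>X Y Y'. smooth_on U X \<longrightarrow> smooth_on U Y \<longrightarrow> smooth_on U Y' \<longrightarrow>
      (\<forall>x\<in>U. D X (\<lambda>y. Y y + Y' y) x = D X Y x + D X Y' x)) \<and>
    (\<forall>f X Y. smooth_on U f \<longrightarrow> smooth_on U X \<longrightarrow> smooth_on U Y \<longrightarrow>
      (\<forall>x\<in>U. D X (\<lambda>y. f y *\<^sub>R Y y) x = vderiv X f x *\<^sub>R Y x + f x *\<^sub>R D X Y x))"

text \<open>The Levi-Civita connection of a Riemannian metric: the torsion-free metric connection. On
  smooth fields its values on \<open>U\<close> are uniquely determined by these conditions.\<close>

definition levi_civita_connection ::
    "(real ^ 'n) set \<Rightarrow> 'n::finite tensor2 \<Rightarrow> 'n connection \<Rightarrow> bool" where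
  "levi_civita_connection U g D \<longleftrightarrow>
    affine_connection U D \<and>
    (\<forall>X Y. smooth_on U X \<longrightarrow> smooth_on U Y \<longrightarrow>
      (\<forall>x\<in>U. D X Y x - D Y X x = lie_bracket X Y x)) \<and>
    (\<forall>X Y Z. smooth_on U X \<longrightarrow> smooth_on U Y \<longrightarrow> smooth_on U Z \<longrightarrow>
      (\<forall>x\<in>U. vderiv X (\<lambda>y. g y (Y y) (Z y)) x =
        g x (D X Y x) (Z x) + g x (Y x) (D X Z x)))"

definition riemann_curvature ::
    "'n::finite connection \<Rightarrow> 'n vfield \<Rightarrow> 'n vfield \<Rightarrow> 'n vfield \<Rightarrow> 'n vfield" where
  "riemann_curvature D X Y Z =
    (\<lambda>x. D X (D Y Z) x - D Y (D X Z) x - D (lie_bracket X Y) Z x)"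

text \<open>Here \<open>E\<close> is meant to be an orthonormal frame for \<open>g\<close>.\<close>

definition ricci_tensor ::
    "'n::finite tensor2 \<Rightarrow> 'n connection \<Rightarrow> ('n \<Rightarrow> 'n vfield) \<Rightarrow>
      'n vfield \<Rightarrow> 'n vfield \<Rightarrow> real ^ 'n \<Rightarrow> real" where
  "ricci_tensor g D E Y Z =
    (\<lambda>x. \<Sum>k\<in>UNIV. g x (riemann_curvature D (E k) Y Z x) (E k x))"

definition lie_derivative_metric ::
    "'n::finite vfield \<Rightarrow> 'n tensor2 \<Rightarrow> 'n vfield \<Rightarrow> 'n vfield \<Rightarrow> real ^ 'n \<Rightarrow> real" where
  "lie_derivative_metric V g Y Z =
    (\<lambda>x. vderiv V (\<lambda>y. g y (Y y) (Z y)) x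
      - g x (lie_bracket V Y x) (Z x) - g x (Y x) (lie_bracket V Z x))"

text \<open>The connection \<open>D\<close> and the frame \<open>E\<close> are auxiliary arguments: they only serve to express the
  Ricci tensor of \<open>g\<close>, which does not depend on their choice.\<close>

definition almost_eta_ricci_soliton ::
    "(real ^ 'n) set \<Rightarrow> 'n::finite tensor2 \<Rightarrow> 'n connection \<Rightarrow> ('n \<Rightarrow> 'n vfield) \<Rightarrow>
      'n vfield \<Rightarrow> 'n oneform \<Rightarrow> (real ^ 'n \<Rightarrow> real) \<Rightarrow> (real ^ 'n \<Rightarrow> real) \<Rightarrow> bool" where
  "almost_eta_ricci_soliton U g D E V \<eta> lam mu \<longleftrightarrow>
    riemannian_metric U g \<and> levi_civita_connection U g D \<and> orthonormal_frame U g E \<and>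
    smooth_on U V \<and> smooth_one_form U \<eta> \<and> smooth_on U lam \<and> smooth_on U mu \<and>
    (\<exists>x\<in>U. mu x \<noteq> 0) \<and>
    (\<forall>Y Z. smooth_on U Y \<longrightarrow> smooth_on U Z \<longrightarrow>
      (\<forall>x\<in>U. 1 / 2 * lie_derivative_metric V g Y Z x + ricci_tensor g D E Y Z x
        + lam x * g x (Y x) (Z x) + mu x * tensor_prod \<eta> \<eta> x (Y x) (Z x) = 0))"

definition open_box :: "real set \<Rightarrow> real set \<Rightarrow> real set \<Rightarrow> (real ^ 3) set" where
  "open_box I1 I2 I3 = {x. x $ 1 \<in> I1 \<and> x $ 2 \<in> I2 \<and> x $ 3 \<in> I3}"

definition diag_metric :: "(real ^ 3 \<Rightarrow> real) \<Rightarrow> (real ^ 3 \<Rightarrow> real) \<Rightarrow> 3 tensor2" where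
  "diag_metric f1 f2 = (\<lambda>x u v.
      1 / (f1 x)\<^sup>2 * tensor_prod (coord_form 1) (coord_form 1) x u v
    + 1 / (f2 x)\<^sup>2 * tensor_prod (coord_form 2) (coord_form 2) x u v
    + tensor_prod (coord_form 3) (coord_form 3) x u v)"

definition diag_frame :: "(real ^ 3 \<Rightarrow> real) \<Rightarrow> (real ^ 3 \<Rightarrow> real) \<Rightarrow> 3 \<Rightarrow> 3 vfield" where
  "diag_frame f1 f2 k =
    (if k = 1 then \<lambda>x. f1 x *\<^sub>R coord_field 1 x
     else if k = 2 then \<lambda>x. f2 x *\<^sub>R coord_field 2 x
     else coord_field 3)"

definition depends_only_on :: "(real ^ 'n) set \<Rightarrow> 'n::finite \<Rightarrow> (real ^ 'n \<Rightarrow> real) \<Rightarrow> bool" where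
  "depends_only_on U i f \<longleftrightarrow> (\<exists>\<phi>. \<forall>x\<in>U. f x = \<phi> (x $ i))"

end

theory Submission
  imports Defs
begin

text \<open>
  Let \<open>a = \<partial>\<^sub>3 f2 / f2\<close>. In the orthonormal frame the only non-trivial bracket is \<open>[E\<^sub>2, E\<^sub>3] = - a E\<^sub>2\<close>, so
  by the Koszul formula the only non-zero covariant derivatives are \<open>D E\<^sub>2 E\<^sub>2 = a E\<^sub>3\<close> and
  \<open>D E\<^sub>2 E\<^sub>3 = - a E\<^sub>2\<close>. Hence \<open>Ric\<close> is diagonal with entries \<open>0, K, K\<close>, where \<open>K = \<partial>\<^sub>3 a - a\<^sup>2\<close>, half the
  Lie derivative of the metric is diagonal with entries \<open>0, - a, 0\<close>, and the soliton equation becomes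
  \<open>\<lambda> = 0\<close>, \<open>\<mu> = - a\<close>, \<open>\<partial>\<^sub>3 a = a\<^sup>2 + a\<close>. The substitution \<open>h = 1 / f2\<close> turns the last equation into the
  linear equation \<open>h'' = h'\<close> with solutions \<open>h = A + B e\<^sup>t\<close>; the two alternatives are \<open>A = 0\<close> and
  \<open>A \<noteq> 0\<close>, and \<open>B \<noteq> 0\<close> because \<open>\<mu>\<close> does not vanish identically.
\<close>

section \<open>Calculus of smooth functions\<close>

text \<open>Functions agreeing near a point have the same derivatives there, so the choice inside
  \<open>frechet_derivative\<close> yields the same map, even where no derivative exists.\<close>

lemma frechet_derivative_cong_open:
  assumes "open U" "x \<in> U" "\<And>y. y \<in> U \<Longrightarrow> f y = g y"
  shows "frechet_derivative f (at x) = frechet_derivative g (at x)"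
proof -
  have "(f has_derivative F) (at x) \<longleftrightarrow> (g has_derivative F) (at x)" for F
    using has_derivative_transform_within_open[OF _ assms(1,2)] assms(3) by metis
  then show ?thesis
    by (simp add: frechet_derivative_def)
qed

lemma differentiable_cong_open:
  assumes "open U" "x \<in> U" "\<And>y. y \<in> U \<Longrightarrow> f y = g y"
  shows "f differentiable (at x) \<longleftrightarrow> g differentiable (at x)"
  unfolding differentiable_def
  using has_derivative_transform_within_open[OF _ assms(1,2)] assms(3) by metis

lemma partial_cong_open:
  assumes "open U" "x \<in> U" "\<And>y. y \<in> U \<Longrightarrow> f y = g y"
  shows "partial i f x = partial i g x"
  using frechet_derivative_cong_open[OF assms] by (simp add: partial_def)

lemma partial_eqI: "(f has_derivative F) (at x) \<Longrightarrow> partial i f x = F (axis i 1)"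
  by (simp add: partial_def frechet_derivative_at[symmetric])

text \<open>A linear map is determined by its values on the standard basis. This turns every
  directional derivative into a finite sum of products.\<close>

lemma has_derivative_partial:
  assumes "f differentiable (at x)"
  shows "(f has_derivative (\<lambda>v. \<Sum>i\<in>UNIV. v $ i *\<^sub>R partial i f x)) (at x)"
proof -
  have F: "(f has_derivative frechet_derivative f (at x)) (at x)"
    using assms frechet_derivative_works by blast
  interpret bounded_linear "frechet_derivative f (at x)"
    using F by (rule has_derivative_bounded_linear)
  have "frechet_derivative f (at x) = (\<lambda>v. \<Sum>i\<in>UNIV. v $ i *\<^sub>R partial i f x)"
  proof
    fix v
    have "frechet_derivative f (at x) v = frechet_derivative f (at x) (\<Sum>i\<in>UNIV. v $ i *\<^sub>R axis i 1)"
      using basis_expansion[of v] by (simp add: scalar_mult_eq_scaleR)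
    then show "frechet_derivative f (at x) v = (\<Sum>i\<in>UNIV. v $ i *\<^sub>R partial i f x)"
      by (simp add: sum scaleR partial_def)
  qed
  with F show ?thesis
    by simp
qed

lemma frechet_derivative_partial:
  assumes "f differentiable (at x)"
  shows "frechet_derivative f (at x) v = (\<Sum>i\<in>UNIV. v $ i *\<^sub>R partial i f x)"
  by (simp add: frechet_derivative_at[OF has_derivative_partial[OF assms], symmetric])

lemma frechet_derivative_add:
  assumes "f differentiable (at x)" "g differentiable (at x)"
  shows "frechet_derivative (\<lambda>y. f y + g y) (at x) v =
    frechet_derivative f (at x) v + frechet_derivative g (at x) v"
  by (simp add: frechet_derivative_at[OF has_derivative_add[OF
        assms[unfolded frechet_derivative_works]], symmetric])

lemma frechet_derivative_scaleR:
  fixes f :: "'a::real_normed_vector \<Rightarrow> real"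
  assumes "f differentiable (at x)" "g differentiable (at x)"
  shows "frechet_derivative (\<lambda>y. f y *\<^sub>R g y) (at x) v =
    f x *\<^sub>R frechet_derivative g (at x) v + frechet_derivative f (at x) v *\<^sub>R g x"
  by (simp add: frechet_derivative_at[OF has_derivative_scaleR[OF
        assms[unfolded frechet_derivative_works]], symmetric])

lemma frechet_derivative_nth:
  assumes "f differentiable (at x)"
  shows "frechet_derivative (\<lambda>y. f y $ i) (at x) v = frechet_derivative f (at x) v $ i"
  by (simp add: frechet_derivative_at[OF bounded_linear.has_derivative[OF bounded_linear_vec_nth
        assms[unfolded frechet_derivative_works]], symmetric])

lemma frechet_derivative_sum:
  assumes "\<And>i. i \<in> A \<Longrightarrow> f i differentiable (at x)"
  shows "frechet_derivative (\<lambda>y. \<Sum>i\<in>A. f i y) (at x) v =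
    (\<Sum>i\<in>A. frechet_derivative (f i) (at x) v)"
  by (simp add: frechet_derivative_at[OF has_derivative_sum[OF
        assms[unfolded frechet_derivative_works]], symmetric])

lemma partial_const [simp]: "partial i (\<lambda>x. c) x = 0"
  by (simp add: partial_def)

lemma partial_add:
  assumes "f differentiable (at x)" "g differentiable (at x)"
  shows "partial i (\<lambda>y. f y + g y) x = partial i f x + partial i g x"
  using assms by (simp add: partial_def frechet_derivative_add)

lemma partial_scaleR:
  fixes f :: "real ^ 'n::finite \<Rightarrow> real"
  assumes "f differentiable (at x)" "g differentiable (at x)"
  shows "partial i (\<lambda>y. f y *\<^sub>R g y) x = f x *\<^sub>R partial i g x + partial i f x *\<^sub>R g x"
  using assms by (simp add: partial_def frechet_derivative_scaleR)

lemma partial_mult: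
  fixes f g :: "real ^ 'n::finite \<Rightarrow> real"
  assumes "f differentiable (at x)" "g differentiable (at x)"
  shows "partial i (\<lambda>y. f y * g y) x = f x * partial i g x + partial i f x * g x"
  using partial_scaleR[OF assms] by simp

lemma partial_inverse:
  fixes f :: "real ^ 'n::finite \<Rightarrow> real"
  assumes "f differentiable (at x)" "f x \<noteq> 0"
  shows "partial i (\<lambda>y. inverse (f y)) x = - (partial i f x * (inverse (f x) * inverse (f x)))"
  by (subst partial_eqI[OF Deriv.has_derivative_inverse[OF assms(2)
        assms(1)[unfolded frechet_derivative_works]]])
    (simp add: partial_def mult_ac)

lemma partial_bounded_linear:
  assumes "bounded_linear h" "f differentiable (at x)"
  shows "partial i (\<lambda>y. h (f y)) x = h (partial i f x)"
  by (subst partial_eqI[OF bounded_linear.has_derivative[OF assms(1)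
        assms(2)[unfolded frechet_derivative_works]]])
    (simp add: partial_def)

text \<open>Closure of \<open>smooth_on\<close> under products and inverses is proved by induction on the order of
  differentiability: the statement for all orders at once does not survive the product rule.\<close>

primrec differentiable_upto ::
    "(real ^ 'n) set \<Rightarrow> nat \<Rightarrow> (real ^ 'n::finite \<Rightarrow> 'b::real_normed_vector) \<Rightarrow> bool" where
  "differentiable_upto U 0 f = True"
| "differentiable_upto U (Suc n) f =
    ((\<forall>x\<in>U. f differentiable (at x)) \<and> (\<forall>i. differentiable_upto U n (partial i f)))"

lemma smooth_on_differentiable: "smooth_on U f \<Longrightarrow> x \<in> U \<Longrightarrow> f differentiable (at x)"
  unfolding smooth_on_def by (metis foldr.simps(1) id_apply)

lemma smooth_on_partial: "smooth_on U f \<Longrightarrow> smooth_on U (partial i f)"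
  unfolding smooth_on_def
proof (intro allI ballI)
  fix "is" x
  assume "\<forall>is. \<forall>x\<in>U. foldr partial is f differentiable (at x)" "x \<in> U"
  then have "foldr partial (is @ [i]) f differentiable (at x)"
    by blast
  then show "foldr partial is (partial i f) differentiable (at x)"
    by simp
qed

lemma smooth_on_iff_differentiable_upto: "smooth_on U f \<longleftrightarrow> (\<forall>n. differentiable_upto U n f)"
proof
  show "\<forall>n. differentiable_upto U n f" if "smooth_on U f"
  proof
    fix n
    show "differentiable_upto U n f"
      using that
      by (induction n arbitrary: f) (auto intro: smooth_on_differentiable smooth_on_partial)
  qed
next
  assume *: "\<forall>n. differentiable_upto U n f"
  have "\<forall>x\<in>U. foldr partial is f differentiable (at x)"
    if "differentiable_upto U (Suc (length is)) f" for "is" and f :: "real ^ 'a \<Rightarrow> 'b"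
    using that
    \<comment> \<open>In \<open>foldr partial is f\<close> the last index of the list is applied
      first, so induction from the right end matches the recursion of
      \<open>differentiable_upto\<close>.\<close>
    by (induction "is" arbitrary: f rule: rev_induct) auto
  with * show "smooth_on U f"
    unfolding smooth_on_def by blast
qed

lemma differentiable_upto_Suc: "differentiable_upto U (Suc n) f \<Longrightarrow> differentiable_upto U n f"
  by (induction n arbitrary: f) auto

text \<open>Rules for partial derivatives are identities at points of \<open>U\<close> only; since
  \<open>U\<close> is open, such an identity survives further differentiation.\<close>

lemma differentiable_upto_cong:
  assumes "open U" "\<And>x. x \<in> U \<Longrightarrow> f x = g x" "differentiable_upto U n f"
  shows "differentiable_upto U n g"
  using assms(2,3)
proof (induction n arbitrary: f g)
  case (Suc n)
  have "g differentiable (at x)" if "x \<in> U" for x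
    using Suc.prems(2) differentiable_cong_open[of U x f g, OF assms(1) that Suc.prems(1)] that
    by simp
  moreover have "differentiable_upto U n (partial i g)" for i
    using Suc.prems partial_cong_open[OF assms(1) _ Suc.prems(1)]
    by (intro Suc.IH[of "partial i f" "partial i g"]) simp_all
  ultimately show ?case
    by simp
qed simp

lemma differentiable_upto_const: "differentiable_upto U n (\<lambda>x. c)"
proof (induction n arbitrary: c)
  case (Suc n)
  have "partial i (\<lambda>x. c) = (\<lambda>x. 0)" for i :: 'a
    by auto
  with Suc show ?case
    by simp
qed simp

section \<open>Closure properties of smooth functions\<close>

context
  fixes U :: "(real ^ 'n::finite) set"
  assumes U: "open U"
begin

lemma differentiable_upto_add:
  assumes "differentiable_upto U n f" "differentiable_upto U n g"
  shows "differentiable_upto U n (\<lambda>x. f x + g x)"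
  using assms
proof (induction n arbitrary: f g)
  case (Suc n)
  have "differentiable_upto U n (partial i (\<lambda>x. f x + g x))" for i
    by (rule differentiable_upto_cong[OF U _ Suc.IH[of "partial i f" "partial i g"]])
      (use Suc.prems in \<open>auto simp: partial_add\<close>)
  with Suc.prems show ?case
    by auto
qed simp

lemma differentiable_upto_bounded_linear:
  assumes "bounded_linear h" "differentiable_upto U n f"
  shows "differentiable_upto U n (\<lambda>x. h (f x))"
  using assms(2)
proof (induction n arbitrary: f)
  case (Suc n)
  have "differentiable_upto U n (partial i (\<lambda>x. h (f x)))" for i
    by (rule differentiable_upto_cong[OF U _ Suc.IH[of "partial i f"]])
      (use Suc.prems in \<open>auto simp: partial_bounded_linear[OF assms(1)]\<close>)
  moreover have "(\<lambda>x. h (f x)) differentiable (at x)" if "x \<in> U" for x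
    by (rule differentiable_compose[of h, OF bounded_linear_imp_differentiable[OF assms(1)]])
      (use Suc.prems that in auto)
  ultimately show ?case
    by simp
qed simp

lemma differentiable_upto_scaleR:
  fixes f :: "real ^ 'n \<Rightarrow> real"
  assumes "differentiable_upto U n f" "differentiable_upto U n g"
  shows "differentiable_upto U n (\<lambda>x. f x *\<^sub>R g x)"
  using assms
proof (induction n arbitrary: f g)
  case (Suc n)
  \<comment> \<open>Each summand pairs a derivative, known to order \<open>n\<close>, with an
    undifferentiated factor that has one order to spare; the induction hypothesis covers both
    because \<open>f\<close> and \<open>g\<close> vary.\<close>
  have "differentiable_upto U n (\<lambda>x. f x *\<^sub>R partial i g x + partial i f x *\<^sub>R g x)" for i
    using Suc.prems by (intro differentiable_upto_add Suc.IH) (auto intro: differentiable_upto_Suc)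
  then have "differentiable_upto U n (partial i (\<lambda>x. f x *\<^sub>R g x))" for i
    by (rule differentiable_upto_cong[OF U, rotated]) (use Suc.prems in \<open>auto simp: partial_scaleR\<close>)
  with Suc.prems show ?case
    by auto
qed simp

lemma differentiable_upto_inverse:
  fixes f :: "real ^ 'n \<Rightarrow> real"
  assumes "differentiable_upto U n f" "\<And>x. x \<in> U \<Longrightarrow> f x \<noteq> 0"
  shows "differentiable_upto U n (\<lambda>x. inverse (f x))"
  using assms(1)
proof (induction n)
  case (Suc n)
  \<comment> \<open>The derivative of the inverse contains the inverse again, but only to order
    \<open>n\<close>, which the induction hypothesis supplies.\<close>
  have "differentiable_upto U n (\<lambda>x. (-1) *\<^sub>R (partial i f x *\<^sub>R (inverse (f x) *\<^sub>R inverse (f x))))" for i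
    using Suc.prems differentiable_upto_Suc[OF Suc.prems]
    by (intro differentiable_upto_scaleR Suc.IH differentiable_upto_const) auto
  then have "differentiable_upto U n (partial i (\<lambda>x. inverse (f x)))" for i
    by (rule differentiable_upto_cong[OF U, rotated])
      (use Suc.prems assms(2) in \<open>auto simp: partial_inverse\<close>)
  with Suc.prems assms(2) show ?case
    by auto
qed simp

lemma smooth_on_cong:
  "(\<And>x. x \<in> U \<Longrightarrow> f x = g x) \<Longrightarrow> smooth_on U f \<Longrightarrow> smooth_on U g"
  using differentiable_upto_cong[OF U] unfolding smooth_on_iff_differentiable_upto by metis

lemma smooth_on_const: "smooth_on U (\<lambda>x. c)"
  unfolding smooth_on_iff_differentiable_upto by (simp add: differentiable_upto_const)

lemma smooth_on_add: "smooth_on U f \<Longrightarrow> smooth_on U g \<Longrightarrow> smooth_on U (\<lambda>x. f x + g x)"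
  unfolding smooth_on_iff_differentiable_upto by (simp add: differentiable_upto_add)

lemma smooth_on_bounded_linear:
  "bounded_linear h \<Longrightarrow> smooth_on U f \<Longrightarrow> smooth_on U (\<lambda>x. h (f x))"
  unfolding smooth_on_iff_differentiable_upto by (simp add: differentiable_upto_bounded_linear)

lemma smooth_on_nth: "smooth_on U f \<Longrightarrow> smooth_on U (\<lambda>x. f x $ i)"
  by (rule smooth_on_bounded_linear[OF bounded_linear_vec_nth])

lemma smooth_on_minus: "smooth_on U f \<Longrightarrow> smooth_on U (\<lambda>x. - f x)"
  by (rule smooth_on_bounded_linear[OF bounded_linear_minus[OF bounded_linear_ident]])

lemma smooth_on_diff: "smooth_on U f \<Longrightarrow> smooth_on U g \<Longrightarrow> smooth_on U (\<lambda>x. f x - g x)"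
  using smooth_on_add[OF _ smooth_on_minus] by fastforce

lemma smooth_on_scaleR:
  "smooth_on U (f :: _ \<Rightarrow> real) \<Longrightarrow> smooth_on U g \<Longrightarrow> smooth_on U (\<lambda>x. f x *\<^sub>R g x)"
  unfolding smooth_on_iff_differentiable_upto by (simp add: differentiable_upto_scaleR)

lemma smooth_on_mult:
  "smooth_on U (f :: _ \<Rightarrow> real) \<Longrightarrow> smooth_on U g \<Longrightarrow> smooth_on U (\<lambda>x. f x * g x)"
  using smooth_on_scaleR[of f g] by simp

lemma smooth_on_inverse:
  "smooth_on U (f :: _ \<Rightarrow> real) \<Longrightarrow> (\<And>x. x \<in> U \<Longrightarrow> f x \<noteq> 0) \<Longrightarrow> smooth_on U (\<lambda>x. inverse (f x))"
  unfolding smooth_on_iff_differentiable_upto by (simp add: differentiable_upto_inverse)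

lemma smooth_on_divide:
  "smooth_on U (f :: _ \<Rightarrow> real) \<Longrightarrow> smooth_on U g \<Longrightarrow> (\<And>x. x \<in> U \<Longrightarrow> g x \<noteq> 0) \<Longrightarrow>
    smooth_on U (\<lambda>x. f x / g x)"
  unfolding divide_inverse by (intro smooth_on_mult smooth_on_inverse)

lemma smooth_on_sum:
  "(\<And>i. i \<in> A \<Longrightarrow> smooth_on U (f i)) \<Longrightarrow> smooth_on U (\<lambda>x. \<Sum>i\<in>A. f i x)"
  by (induction A rule: infinite_finite_induct) (auto intro: smooth_on_const smooth_on_add)

lemmas smooth_on_intros =
  smooth_on_const smooth_on_add smooth_on_nth smooth_on_minus smooth_on_diff smooth_on_scaleR
  smooth_on_mult smooth_on_inverse smooth_on_divide smooth_on_sum smooth_on_partial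

text \<open>On \<open>U\<close> the expansion in partial derivatives exhibits the function as a sum
  of products of smooth functions.\<close>

lemma smooth_on_frechet_derivative:
  assumes "smooth_on U f" "smooth_on U X"
  shows "smooth_on U (\<lambda>x. frechet_derivative f (at x) (X x))"
proof (rule smooth_on_cong)
  show "smooth_on U (\<lambda>x. \<Sum>i\<in>UNIV. X x $ i *\<^sub>R partial i f x)"
    using assms by (intro smooth_on_intros)
qed (simp add: frechet_derivative_partial[OF smooth_on_differentiable[OF assms(1)]])

lemma smooth_on_vderiv: "smooth_on U X \<Longrightarrow> smooth_on U f \<Longrightarrow> smooth_on U (vderiv X f)"
  unfolding vderiv_def by (rule smooth_on_frechet_derivative)

lemma smooth_on_lie_bracket: "smooth_on U X \<Longrightarrow> smooth_on U Y \<Longrightarrow> smooth_on U (lie_bracket X Y)"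
  unfolding lie_bracket_def by (intro smooth_on_diff smooth_on_frechet_derivative)

end

section \<open>Restriction to coordinate lines and symmetry of mixed derivatives\<close>

lemma has_real_derivative_along_axis:
  fixes f :: "real ^ 'n::finite \<Rightarrow> real"
  assumes "f differentiable (at (y + s *\<^sub>R axis i 1))"
  shows "((\<lambda>s. f (y + s *\<^sub>R axis i 1)) has_real_derivative partial i f (y + s *\<^sub>R axis i 1)) (at s)"
proof -
  let ?z = "y + s *\<^sub>R axis i 1"
  have F: "(f has_derivative frechet_derivative f (at ?z)) (at ?z)"
    using assms frechet_derivative_works by blast
  have "((\<lambda>s. y + s *\<^sub>R axis i 1) has_derivative (\<lambda>h. h *\<^sub>R axis i 1)) (at s)"
    by (auto intro!: derivative_eq_intros)
  from has_derivative_compose[OF this F] show ?thesis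
    using linear_scale[OF has_derivative_linear[OF F]]
    by (simp add: has_field_derivative_def partial_def mult_commute_abs)
qed

lemma second_difference_mean_value:
  fixes f :: "real ^ 'n::finite \<Rightarrow> real"
  assumes "smooth_on U f" "ball x r \<subseteq> U" "0 < t" "2 * t < r"
  shows "\<exists>p\<in>ball x r. f (x + t *\<^sub>R axis i 1 + t *\<^sub>R axis j 1) - f (x + t *\<^sub>R axis i 1)
      - f (x + t *\<^sub>R axis j 1) + f x = t * t * partial j (partial i f) p"
proof -
  \<comment> \<open>The displacement has norm at most \<open>s + s'\<close>, hence at most
    \<open>2 * t\<close>, so every point used below stays in the ball.\<close>
  have mem: "x + s *\<^sub>R axis i 1 + s' *\<^sub>R axis j 1 \<in> ball x r"
    if "0 \<le> s" "s \<le> t" "0 \<le> s'" "s' \<le> t" for s s' :: real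
  proof -
    have "norm (s *\<^sub>R axis i 1 + s' *\<^sub>R axis j (1::real) :: real ^ 'n) \<le> s + s'"
      using norm_triangle_ineq[of "s *\<^sub>R axis i 1" "s' *\<^sub>R axis j (1::real)"] that
      by simp
    then have "dist (x + (s *\<^sub>R axis i 1 + s' *\<^sub>R axis j 1)) x < r"
      using that assms(4) by (simp add: dist_norm)
    then show ?thesis
      by (simp add: add.assoc dist_commute)
  qed
  have mem': "x + s *\<^sub>R axis i 1 \<in> ball x r" if "0 \<le> s" "s \<le> t" for s :: real
    using mem[of s 0] that assms(3) by simp
  have diff: "h differentiable (at z)" if "smooth_on U h" "z \<in> ball x r" for h :: "real ^ 'n \<Rightarrow> real" and z
    using smooth_on_differentiable that assms(2) by blast
  \<comment> \<open>The second difference is the increment of \<open>?\<phi>\<close> from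
    \<open>0\<close> to \<open>t\<close>. The mean value theorem yields a derivative in direction
    \<open>i\<close>; applied once more, to \<open>?\<psi>\<close>, it yields the one in direction
    \<open>j\<close>.\<close>
  let ?\<phi> = "\<lambda>s. f (x + t *\<^sub>R axis j 1 + s *\<^sub>R axis i 1) - f (x + s *\<^sub>R axis i 1)"
  have "\<exists>z>0. z < t \<and> ?\<phi> t - ?\<phi> 0 =
      (t - 0) * (partial i f (x + t *\<^sub>R axis j 1 + z *\<^sub>R axis i 1) - partial i f (x + z *\<^sub>R axis i 1))"
    using assms(3) mem mem'
    by (intro MVT2 DERIV_diff has_real_derivative_along_axis diff assms(1))
      (auto simp: add.assoc add.commute[of "t *\<^sub>R axis j 1"])
  then obtain s where s: "0 < s" "s < t" and 1: "?\<phi> t - ?\<phi> 0 =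
      t * (partial i f (x + t *\<^sub>R axis j 1 + s *\<^sub>R axis i 1) - partial i f (x + s *\<^sub>R axis i 1))"
    by auto
  let ?\<psi> = "\<lambda>u. partial i f (x + s *\<^sub>R axis i 1 + u *\<^sub>R axis j 1)"
  have "\<exists>z>0. z < t \<and> ?\<psi> t - ?\<psi> 0 =
      (t - 0) * partial j (partial i f) (x + s *\<^sub>R axis i 1 + z *\<^sub>R axis j 1)"
    using assms(3) mem s
    by (intro MVT2 has_real_derivative_along_axis diff smooth_on_partial assms(1)) auto
  then obtain u where u: "0 < u" "u < t" and 2: "?\<psi> t - ?\<psi> 0 =
      t * partial j (partial i f) (x + s *\<^sub>R axis i 1 + u *\<^sub>R axis j 1)"
    by auto
  show ?thesis
  proof (rule bexI)
    show "x + s *\<^sub>R axis i 1 + u *\<^sub>R axis j 1 \<in> ball x r"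
      using mem s u by simp
    show "f (x + t *\<^sub>R axis i 1 + t *\<^sub>R axis j 1) - f (x + t *\<^sub>R axis i 1) - f (x + t *\<^sub>R axis j 1) + f x
      = t * t * partial j (partial i f) (x + s *\<^sub>R axis i 1 + u *\<^sub>R axis j 1)"
      using 1 2 by (simp add: add.assoc add.commute[of "_ *\<^sub>R axis j 1"])
  qed
qed

text \<open>Schwarz: on every small square both mixed derivatives attain the value given by the same second
  difference, so by continuity they agree at the centre.\<close>

lemma partial_commute:
  fixes f :: "real ^ 'n::finite \<Rightarrow> real"
  assumes "open U" "smooth_on U f" "x \<in> U"
  shows "partial i (partial j f) x = partial j (partial i f) x"
proof (rule ccontr)
  let ?g = "partial i (partial j f)" and ?h = "partial j (partial i f)"
  define e where "e = \<bar>?g x - ?h x\<bar> / 2"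
  assume "?g x \<noteq> ?h x"
  then have e: "e > 0"
    by (simp add: e_def)
  have near: "\<exists>r>0. \<forall>y\<in>ball x r. \<bar>k y - k x\<bar> < e" if "smooth_on U k" for k :: "real ^ 'n \<Rightarrow> real"
  proof -
    have "isCont k x"
      using smooth_on_differentiable[OF that assms(3)] by (rule differentiable_imp_continuous_within)
    then obtain d where "d > 0" "\<forall>y. dist y x < d \<longrightarrow> dist (k y) (k x) < e"
      using e unfolding continuous_at_eps_delta by (elim allE[of _ e]) auto
    then show ?thesis
      by (intro exI[of _ d]) (simp add: dist_commute[of x] flip: dist_real_def)
  qed
  obtain r1 where r1: "r1 > 0" "\<And>y. y \<in> ball x r1 \<Longrightarrow> \<bar>?g y - ?g x\<bar> < e"
    using near[OF smooth_on_partial[OF smooth_on_partial[OF assms(2)]]] by blast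
  obtain r2 where r2: "r2 > 0" "\<And>y. y \<in> ball x r2 \<Longrightarrow> \<bar>?h y - ?h x\<bar> < e"
    using near[OF smooth_on_partial[OF smooth_on_partial[OF assms(2)]]] by blast
  obtain r3 where r3: "r3 > 0" "ball x r3 \<subseteq> U"
    using assms(1,3) openE by blast
  define r where "r = min r1 (min r2 r3)"
  have r: "r > 0" "ball x r \<subseteq> U" "ball x r \<subseteq> ball x r1" "ball x r \<subseteq> ball x r2"
    using r1(1) r2(1) r3 unfolding r_def by auto
  have t: "0 < r / 3" "2 * (r / 3) < r"
    using r(1) by auto
  obtain p where p: "p \<in> ball x r"
    "f (x + (r/3) *\<^sub>R axis i 1 + (r/3) *\<^sub>R axis j 1) - f (x + (r/3) *\<^sub>R axis i 1)
      - f (x + (r/3) *\<^sub>R axis j 1) + f x = r/3 * (r/3) * ?h p"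
    using second_difference_mean_value[OF assms(2) r(2) t, of i j] by blast
  obtain q where q: "q \<in> ball x r"
    "f (x + (r/3) *\<^sub>R axis j 1 + (r/3) *\<^sub>R axis i 1) - f (x + (r/3) *\<^sub>R axis j 1)
      - f (x + (r/3) *\<^sub>R axis i 1) + f x = r/3 * (r/3) * ?g q"
    using second_difference_mean_value[OF assms(2) r(2) t, of j i] by blast
  have swap: "x + (r/3) *\<^sub>R axis j 1 + (r/3) *\<^sub>R axis i 1 = x + (r/3) *\<^sub>R axis i 1 + (r/3) *\<^sub>R axis j 1"
    by (simp add: add_ac)
  have "r/3 * (r/3) * ?h p = r/3 * (r/3) * ?g q"
    using p(2) q(2)[unfolded swap] by linarith
  then have "?h p = ?g q"
    using r(1) by simp
  moreover have "\<bar>?g q - ?g x\<bar> < e" "\<bar>?h p - ?h x\<bar> < e"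
    using r1(2) r2(2) p(1) q(1) r(3,4) by blast+
  ultimately show False
    unfolding e_def by argo
qed

section \<open>The Levi-Civita connection and its curvature\<close>

lemma vderiv_partial:
  "f differentiable (at x) \<Longrightarrow> vderiv X f x = (\<Sum>i\<in>UNIV. X x $ i * partial i f x)"
  by (simp add: vderiv_def frechet_derivative_partial)

text \<open>The second-order terms cancel by symmetry of the mixed derivatives; the coefficients of
  the remaining first-order terms are the components of the bracket.\<close>

lemma vderiv_commute:
  assumes "open U" "smooth_on U X" "smooth_on U Y" "smooth_on U f" "x \<in> U"
  shows "vderiv X (vderiv Y f) x - vderiv Y (vderiv X f) x = vderiv (lie_bracket X Y) f x"
proof -
  note diff = smooth_on_differentiable[OF _ assms(5)]
  have expand: "vderiv V (vderiv W f) x =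
      (\<Sum>i\<in>UNIV. \<Sum>j\<in>UNIV. W x $ i * V x $ j * partial j (partial i f) x) +
      (\<Sum>i\<in>UNIV. frechet_derivative W (at x) (V x) $ i * partial i f x)"
    if V: "smooth_on U V" and W: "smooth_on U W" for V W
  proof -
    have "vderiv V (vderiv W f) x = vderiv V (\<lambda>y. \<Sum>i\<in>UNIV. W y $ i *\<^sub>R partial i f y) x"
      unfolding vderiv_def[of V]
      by (subst frechet_derivative_cong_open[OF assms(1,5)])
        (simp_all add: vderiv_partial smooth_on_differentiable[OF assms(4)])
    also have "\<dots> = (\<Sum>i\<in>UNIV. W x $ i * vderiv V (partial i f) x +
        frechet_derivative W (at x) (V x) $ i * partial i f x)"
      using assms(1,4) W unfolding vderiv_def
      by (simp add: frechet_derivative_sum frechet_derivative_scaleR frechet_derivative_nth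
          diff smooth_on_scaleR smooth_on_nth smooth_on_partial del: real_scaleR_def)
        simp
    also have "\<dots> = (\<Sum>i\<in>UNIV. (\<Sum>j\<in>UNIV. W x $ i * V x $ j * partial j (partial i f) x) +
        frechet_derivative W (at x) (V x) $ i * partial i f x)"
      using assms(4) by (simp add: vderiv_partial diff smooth_on_partial sum_distrib_left mult_ac)
    finally show ?thesis
      by (simp add: sum.distrib)
  qed
  have "(\<Sum>i\<in>UNIV. \<Sum>j\<in>UNIV. Y x $ i * X x $ j * partial j (partial i f) x) =
      (\<Sum>i\<in>UNIV. \<Sum>j\<in>UNIV. X x $ i * Y x $ j * partial j (partial i f) x)"
    by (subst sum.swap) (simp add: partial_commute[OF assms(1,4,5)] mult_ac)
  then show ?thesis
    using assms(2-4)
    by (simp add: expand vderiv_partial diff lie_bracket_def sum_subtractf left_diff_distrib)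
qed

section \<open>Locality of the connection and the Koszul formula\<close>

locale levi_civita =
  fixes U :: "(real ^ 'n::finite) set" and g :: "'n tensor2" and D :: "'n connection"
  assumes metric: "riemannian_metric U g" and connection: "levi_civita_connection U g D"
begin

lemma open_U: "open U"
  using metric by (simp add: riemannian_metric_def)

lemmas smooth_intros = smooth_on_intros[OF open_U] smooth_on_vderiv[OF open_U]
  smooth_on_lie_bracket[OF open_U]

lemma
  assumes "x \<in> U"
  shows metric_bilinear: "bilinear (g x)"
    and metric_sym: "g x u v = g x v u"
  using assms metric by (auto simp: riemannian_metric_def)

lemmas metric_simps =
  bilinear_ladd[OF metric_bilinear] bilinear_radd[OF metric_bilinear]
  bilinear_lsub[OF metric_bilinear] bilinear_rsub[OF metric_bilinear]
  bilinear_lmul[OF metric_bilinear] bilinear_rmul[OF metric_bilinear]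
  bilinear_lneg[OF metric_bilinear] bilinear_rneg[OF metric_bilinear]
  bilinear_lzero[OF metric_bilinear] bilinear_rzero[OF metric_bilinear]

lemmas conn_affine = connection[unfolded levi_civita_connection_def affine_connection_def, THEN conjunct1]
  and conn_compatible = connection[unfolded levi_civita_connection_def, THEN conjunct2]

lemmas smooth_conn = conn_affine[THEN conjunct1, rule_format]
  and conn_add_left = conn_affine[THEN conjunct2, THEN conjunct1, rule_format]
  and conn_scale_left = conn_affine[THEN conjunct2, THEN conjunct2, THEN conjunct1, rule_format]
  and conn_add_right =
    conn_affine[THEN conjunct2, THEN conjunct2, THEN conjunct2, THEN conjunct1, rule_format]
  and conn_leibniz =
    conn_affine[THEN conjunct2, THEN conjunct2, THEN conjunct2, THEN conjunct2, rule_format]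
  and torsion_free = conn_compatible[THEN conjunct1, rule_format]
  and metric_compatible = conn_compatible[THEN conjunct2, rule_format]

lemma smooth_on_indicator_compl: "smooth_on U (indicat_real (- U))"
  by (rule smooth_on_cong[OF open_U _ smooth_on_const[OF open_U, of 0]]) auto

lemma vderiv_cong:
  "x \<in> U \<Longrightarrow> (\<And>y. y \<in> U \<Longrightarrow> f y = h y) \<Longrightarrow> vderiv X f x = vderiv X h x"
  by (simp add: vderiv_def frechet_derivative_cong_open[OF open_U, of x f h])

text \<open>A field vanishing on \<open>U\<close> is unchanged by multiplication with the indicator of the complement,
  a function whose germ at every point of \<open>U\<close> is zero; so the connection axioms force \<open>D\<close> to be local.\<close>

lemma conn_cong_left:
  assumes "smooth_on U X" "smooth_on U X'" "smooth_on U Y" "\<And>y. y \<in> U \<Longrightarrow> X y = X' y" "x \<in> U"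
  shows "D X Y x = D X' Y x"
proof -
  let ?W = "\<lambda>y. X y - X' y"
  have W: "smooth_on U ?W"
    using assms by (intro smooth_intros)
  have "D ?W Y x = D (\<lambda>y. indicat_real (- U) y *\<^sub>R ?W y) Y x"
    by (rule arg_cong[where f = "\<lambda>W. D W Y x"]) (use assms(4) in \<open>auto simp: indicator_def\<close>)
  also have "\<dots> = 0"
    using assms(5) by (simp add: conn_scale_left[OF smooth_on_indicator_compl W assms(3)])
  finally show ?thesis
    using conn_add_left[OF assms(2) W assms(3,5)] by simp
qed

lemma conn_cong_right:
  assumes "smooth_on U X" "smooth_on U Y" "smooth_on U Y'" "\<And>y. y \<in> U \<Longrightarrow> Y y = Y' y" "x \<in> U"
  shows "D X Y x = D X Y' x"
proof -
  let ?W = "\<lambda>y. Y y - Y' y"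
  have W: "smooth_on U ?W"
    using assms by (intro smooth_intros)
  have "vderiv X (indicat_real (- U)) x = vderiv X (\<lambda>_. 0) x"
    using assms(5) by (rule vderiv_cong) auto
  then have "vderiv X (indicat_real (- U)) x = 0"
    by (simp add: vderiv_def)
  have "D X ?W x = D X (\<lambda>y. indicat_real (- U) y *\<^sub>R ?W y) x"
    by (rule arg_cong[where f = "\<lambda>W. D X W x"]) (use assms(4) in \<open>auto simp: indicator_def\<close>)
  also have "\<dots> = 0"
    using assms(5) \<open>vderiv X (indicat_real (- U)) x = 0\<close>
    by (simp add: conn_leibniz[OF smooth_on_indicator_compl assms(1) W])
  finally show ?thesis
    using conn_add_right[OF assms(1,3) W assms(5)] by simp
qed

lemma conn_zero_left: "smooth_on U Y \<Longrightarrow> x \<in> U \<Longrightarrow> D (\<lambda>y. 0) Y x = 0"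
  using conn_scale_left[of "\<lambda>y. 0" "\<lambda>y. 0" Y x] by (simp add: smooth_intros)

lemma conn_sum_left:
  assumes "\<And>i. smooth_on U (f i)" "\<And>i. smooth_on U (X i)" "smooth_on U Y" "x \<in> U"
  shows "D (\<lambda>y. \<Sum>i\<in>A. f i y *\<^sub>R X i y) Y x = (\<Sum>i\<in>A. f i x *\<^sub>R D (X i) Y x)"
  using assms
  by (induction A rule: infinite_finite_induct)
    (simp_all add: conn_zero_left conn_add_left conn_scale_left smooth_intros)

text \<open>Expand the metric derivatives by compatibility and the brackets by torsion-freeness: by
  symmetry of the metric all but two equal terms cancel. On a frame this expresses the connection
  through brackets.\<close>

lemma koszul:
  assumes "smooth_on U X" "smooth_on U Y" "smooth_on U Z" "x \<in> U"
  shows "2 * g x (D X Y x) (Z x) =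
    vderiv X (\<lambda>y. g y (Y y) (Z y)) x + vderiv Y (\<lambda>y. g y (Z y) (X y)) x
    - vderiv Z (\<lambda>y. g y (X y) (Y y)) x + g x (lie_bracket X Y x) (Z x)
    - g x (lie_bracket X Z x) (Y x) - g x (lie_bracket Y Z x) (X x)"
  using assms metric_sym[OF assms(4)]
  by (simp add: metric_compatible metric_simps flip: torsion_free)

text \<open>Compatibility produces \<open>D V Y\<close> and \<open>D V Z\<close>; subtracting the
  brackets turns them into \<open>D Y V\<close> and \<open>D Z V\<close>, as there is no
  torsion.\<close>

lemma lie_derivative_metric_eq:
  assumes "smooth_on U V" "smooth_on U Y" "smooth_on U Z" "x \<in> U"
  shows "lie_derivative_metric V g Y Z x = g x (D Y V x) (Z x) + g x (Y x) (D Z V x)"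
  using assms by (simp add: lie_derivative_metric_def metric_compatible metric_simps flip: torsion_free)

section \<open>Tensoriality of the curvature and of the Ricci tensor\<close>

lemma lie_bracket_add_right:
  assumes "smooth_on U X" "smooth_on U Y" "smooth_on U Y'" "x \<in> U"
  shows "lie_bracket X (\<lambda>y. Y y + Y' y) x = lie_bracket X Y x + lie_bracket X Y' x"
  using assms
  by (simp add: lie_bracket_def frechet_derivative_add smooth_on_differentiable[of U]
      linear_add[OF linear_frechet_derivative])

lemma lie_bracket_scale_right:
  assumes "smooth_on U X" "smooth_on U Y" "smooth_on U f" "x \<in> U"
  shows "lie_bracket X (\<lambda>y. f y *\<^sub>R Y y) x = f x *\<^sub>R lie_bracket X Y x + vderiv X f x *\<^sub>R Y x"
  using assms
  by (simp add: lie_bracket_def vderiv_def frechet_derivative_scaleR smooth_on_differentiable[of U]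
      linear_scale[OF linear_frechet_derivative] algebra_simps)

text \<open>\<open>D\<close> and the bracket are local, so a field may be replaced by an expression
  equal to it on \<open>U\<close> only, such as its frame expansion.\<close>

lemma riemann_cong_middle:
  assumes "smooth_on U X" "smooth_on U Y" "smooth_on U Y'" "smooth_on U Z"
    "\<And>y. y \<in> U \<Longrightarrow> Y y = Y' y" "x \<in> U"
  shows "riemann_curvature D X Y Z x = riemann_curvature D X Y' Z x"
proof -
  have "D X (D Y Z) x = D X (D Y' Z) x"
    using assms by (intro conn_cong_right smooth_conn conn_cong_left)
  moreover have "D Y (D X Z) x = D Y' (D X Z) x"
    using assms by (intro conn_cong_left smooth_conn)
  moreover have "lie_bracket X Y y = lie_bracket X Y' y" if "y \<in> U" for y
    using that assms(5) by (simp add: lie_bracket_def frechet_derivative_cong_open[OF open_U that assms(5)])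
  then have "D (lie_bracket X Y) Z x = D (lie_bracket X Y') Z x"
    using assms by (intro conn_cong_left smooth_intros)
  ultimately show ?thesis
    by (simp add: riemann_curvature_def)
qed

lemma riemann_cong_right:
  assumes "smooth_on U X" "smooth_on U Y" "smooth_on U Z" "smooth_on U Z'"
    "\<And>y. y \<in> U \<Longrightarrow> Z y = Z' y" "x \<in> U"
  shows "riemann_curvature D X Y Z x = riemann_curvature D X Y Z' x"
proof -
  have "D V (D W Z) x = D V (D W Z') x" if "smooth_on U V" "smooth_on U W" for V W
    using assms that by (intro conn_cong_right smooth_conn) auto
  moreover have "D (lie_bracket X Y) Z x = D (lie_bracket X Y) Z' x"
    using assms by (intro conn_cong_right smooth_intros) auto
  ultimately show ?thesis
    using assms by (simp add: riemann_curvature_def)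
qed

lemma riemann_add_middle:
  assumes "smooth_on U X" "smooth_on U Y" "smooth_on U Y'" "smooth_on U Z" "x \<in> U"
  shows "riemann_curvature D X (\<lambda>y. Y y + Y' y) Z x =
    riemann_curvature D X Y Z x + riemann_curvature D X Y' Z x"
proof -
  have "D X (D (\<lambda>y. Y y + Y' y) Z) x = D X (\<lambda>y. D Y Z y + D Y' Z y) x"
    using assms by (intro conn_cong_right smooth_conn smooth_intros conn_add_left)
  moreover have "D (lie_bracket X (\<lambda>y. Y y + Y' y)) Z x =
      D (\<lambda>y. lie_bracket X Y y + lie_bracket X Y' y) Z x"
    using assms by (intro conn_cong_left smooth_intros lie_bracket_add_right)
  ultimately show ?thesis
    using assms
    by (simp add: riemann_curvature_def conn_add_left conn_add_right smooth_conn smooth_intros)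
qed

text \<open>The Leibniz rule produces \<open>vderiv X f\<close> times \<open>D Y Z\<close>; the
  derivative term in the bracket of \<open>X\<close> with the scaled field produces it again, and
  the curvature subtracts the two.\<close>

lemma riemann_scale_middle:
  assumes "smooth_on U X" "smooth_on U Y" "smooth_on U f" "smooth_on U Z" "x \<in> U"
  shows "riemann_curvature D X (\<lambda>y. f y *\<^sub>R Y y) Z x = f x *\<^sub>R riemann_curvature D X Y Z x"
proof -
  have "D X (D (\<lambda>y. f y *\<^sub>R Y y) Z) x = D X (\<lambda>y. f y *\<^sub>R D Y Z y) x"
    using assms by (intro conn_cong_right smooth_conn smooth_intros conn_scale_left)
  moreover have "D (lie_bracket X (\<lambda>y. f y *\<^sub>R Y y)) Z x =
      D (\<lambda>y. f y *\<^sub>R lie_bracket X Y y + vderiv X f y *\<^sub>R Y y) Z x"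
    using assms by (intro conn_cong_left smooth_intros lie_bracket_scale_right)
  ultimately show ?thesis
    using assms
    by (simp add: riemann_curvature_def conn_add_left conn_scale_left conn_leibniz smooth_conn
        smooth_intros algebra_simps)
qed

lemma riemann_add_right:
  assumes "smooth_on U X" "smooth_on U Y" "smooth_on U Z" "smooth_on U Z'" "x \<in> U"
  shows "riemann_curvature D X Y (\<lambda>y. Z y + Z' y) x =
    riemann_curvature D X Y Z x + riemann_curvature D X Y Z' x"
proof -
  have "D V (D W (\<lambda>y. Z y + Z' y)) x = D V (\<lambda>y. D W Z y + D W Z' y) x"
    if "smooth_on U V" "smooth_on U W" for V W
    using assms that by (intro conn_cong_right smooth_conn smooth_intros conn_add_right)
  then show ?thesis
    using assms by (simp add: riemann_curvature_def conn_add_right smooth_conn smooth_intros)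
qed

lemma riemann_scale_right:
  assumes "smooth_on U X" "smooth_on U Y" "smooth_on U f" "smooth_on U Z" "x \<in> U"
  shows "riemann_curvature D X Y (\<lambda>y. f y *\<^sub>R Z y) x = f x *\<^sub>R riemann_curvature D X Y Z x"
proof -
  \<comment> \<open>The two terms with one derivative of \<open>f\<close> are together symmetric in
    \<open>V\<close> and \<open>W\<close> and drop out of the commutator. The terms with two
    derivatives leave the bracket derivative of \<open>f\<close>, which the last term of the
    curvature removes.\<close>
  have "D V (D W (\<lambda>y. f y *\<^sub>R Z y)) x =
      vderiv V (vderiv W f) x *\<^sub>R Z x + vderiv W f x *\<^sub>R D V Z x
      + vderiv V f x *\<^sub>R D W Z x + f x *\<^sub>R D V (D W Z) x"
    if "smooth_on U V" "smooth_on U W" for V W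
  proof -
    have "D V (D W (\<lambda>y. f y *\<^sub>R Z y)) x = D V (\<lambda>y. vderiv W f y *\<^sub>R Z y + f y *\<^sub>R D W Z y) x"
      using assms that by (intro conn_cong_right smooth_conn smooth_intros conn_leibniz)
    then show ?thesis
      using assms that by (simp add: conn_add_right conn_leibniz smooth_conn smooth_intros)
  qed
  then show ?thesis
    using assms
    by (simp add: riemann_curvature_def conn_leibniz smooth_intros algebra_simps
        flip: vderiv_commute[OF open_U])
qed

lemma riemann_sum_middle:
  assumes "smooth_on U X" "\<And>i. smooth_on U (Y i)" "\<And>i. smooth_on U (f i)" "smooth_on U Z" "x \<in> U"
  shows "riemann_curvature D X (\<lambda>y. \<Sum>i\<in>A. f i y *\<^sub>R Y i y) Z x =
    (\<Sum>i\<in>A. f i x *\<^sub>R riemann_curvature D X (Y i) Z x)"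
proof -
  have "riemann_curvature D X (\<lambda>y. 0) Z x = 0"
    using riemann_scale_middle[of X "\<lambda>y. 0" "\<lambda>y. 0" Z x] assms by (simp add: smooth_intros)
  then show ?thesis
    using assms
    by (induction A rule: infinite_finite_induct)
      (simp_all add: riemann_add_middle riemann_scale_middle smooth_intros)
qed

lemma riemann_sum_right:
  assumes "smooth_on U X" "smooth_on U Y" "\<And>i. smooth_on U (Z i)" "\<And>i. smooth_on U (f i)" "x \<in> U"
  shows "riemann_curvature D X Y (\<lambda>y. \<Sum>i\<in>A. f i y *\<^sub>R Z i y) x =
    (\<Sum>i\<in>A. f i x *\<^sub>R riemann_curvature D X Y (Z i) x)"
proof -
  have "riemann_curvature D X Y (\<lambda>y. 0) x = 0"
    using riemann_scale_right[of X Y "\<lambda>y. 0" "\<lambda>y. 0" x] assms by (simp add: smooth_intros)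
  then show ?thesis
    using assms
    by (induction A rule: infinite_finite_induct)
      (simp_all add: riemann_add_right riemann_scale_right smooth_intros)
qed

text \<open>Tensoriality in both arguments reduces the Ricci tensor to its values on frame fields;
  only the coefficients at \<open>x\<close> enter.\<close>

lemma ricci_tensor_expand:
  assumes "\<And>k. smooth_on U (E k)" "\<And>i. smooth_on U (a i)" "\<And>i. smooth_on U (b i)"
    and "smooth_on U Y" "smooth_on U Z"
    and "\<And>y. y \<in> U \<Longrightarrow> Y y = (\<Sum>i\<in>UNIV. a i y *\<^sub>R E i y)"
    and "\<And>y. y \<in> U \<Longrightarrow> Z y = (\<Sum>i\<in>UNIV. b i y *\<^sub>R E i y)" and "x \<in> U"
  shows "ricci_tensor g D E Y Z x =
    (\<Sum>i\<in>UNIV. \<Sum>j\<in>UNIV. a i x * b j x * ricci_tensor g D E (E i) (E j) x)"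
proof -
  let ?R = "riemann_curvature D"
  have R: "?R (E k) Y Z x = (\<Sum>i\<in>UNIV. \<Sum>j\<in>UNIV. (a i x * b j x) *\<^sub>R ?R (E k) (E i) (E j) x)" for k
  proof -
    have "?R (E k) Y Z x = ?R (E k) (\<lambda>y. \<Sum>i\<in>UNIV. a i y *\<^sub>R E i y) Z x"
      using assms by (intro riemann_cong_middle smooth_intros)
    also have "\<dots> = (\<Sum>i\<in>UNIV. a i x *\<^sub>R ?R (E k) (E i) Z x)"
      using assms by (intro riemann_sum_middle)
    also have "\<dots> = (\<Sum>i\<in>UNIV. a i x *\<^sub>R ?R (E k) (E i) (\<lambda>y. \<Sum>j\<in>UNIV. b j y *\<^sub>R E j y) x)"
      using assms by (intro sum.cong refl arg_cong[where f = "(*\<^sub>R) _"] riemann_cong_right smooth_intros)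
    also have "\<dots> = (\<Sum>i\<in>UNIV. a i x *\<^sub>R (\<Sum>j\<in>UNIV. b j x *\<^sub>R ?R (E k) (E i) (E j) x))"
      using assms by (intro sum.cong refl arg_cong[where f = "(*\<^sub>R) _"] riemann_sum_right)
    finally show ?thesis
      by (simp add: scaleR_sum_right)
  qed
  have lin: "linear (\<lambda>u. g x u v)" for v
    using metric_bilinear[OF assms(8)] by (simp add: bilinear_def)
  have "ricci_tensor g D E Y Z x =
      (\<Sum>k\<in>UNIV. \<Sum>i\<in>UNIV. \<Sum>j\<in>UNIV. a i x * b j x * g x (?R (E k) (E i) (E j) x) (E k x))"
    by (simp add: ricci_tensor_def R linear_sum[OF lin] linear_scale[OF lin])
  \<comment> \<open>The trace index \<open>k\<close> is moved innermost, where its sum is the Ricci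
    tensor of two frame fields.\<close>
  also have "\<dots> = (\<Sum>i\<in>UNIV. \<Sum>k\<in>UNIV. \<Sum>j\<in>UNIV. a i x * b j x * g x (?R (E k) (E i) (E j) x) (E k x))"
    by (rule sum.swap)
  also have "\<dots> = (\<Sum>i\<in>UNIV. \<Sum>j\<in>UNIV. \<Sum>k\<in>UNIV. a i x * b j x * g x (?R (E k) (E i) (E j) x) (E k x))"
    by (intro sum.cong refl sum.swap)
  finally show ?thesis
    by (simp add: ricci_tensor_def sum_distrib_left)
qed

end

section \<open>The diagonal metric\<close>

lemma partial_depends_only_on:
  fixes f :: "real ^ 'n::finite \<Rightarrow> real"
  assumes "open U" "depends_only_on U i f" "x \<in> U" "f differentiable (at x)" "j \<noteq> i"
  shows "partial j f x = 0"
proof -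
  let ?l = "\<lambda>s. x + s *\<^sub>R axis j 1"
  \<comment> \<open>On this open neighbourhood of \<open>0\<close>, moving in direction
    \<open>j\<close> leaves coordinate \<open>i\<close>, and hence \<open>f\<close>,
    unchanged.\<close>
  have l: "open (?l -` U)"
    by (intro open_vimage assms(1) continuous_intros)
  have const: "f x = f (?l s)" if "s \<in> ?l -` U" for s
    using assms(2,3,5) that by (auto simp: depends_only_on_def axis_def)
  have "((\<lambda>s. f (?l s)) has_real_derivative 0) (at 0)"
    by (rule has_field_derivative_transform_within_open[OF DERIV_const l _ const]) (use assms(3) in auto)
  moreover have "((\<lambda>s. f (?l s)) has_real_derivative partial j f x) (at 0)"
    using has_real_derivative_along_axis[of f x 0 j] assms(4) by simp
  ultimately show ?thesis
    using DERIV_unique by blast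
qed

lemma partial_coordinate_function:
  fixes f :: "real ^ 'n::finite \<Rightarrow> real"
  assumes "open U" "x \<in> U" "\<And>y. y \<in> U \<Longrightarrow> f y = F (y $ i)"
    and "(F has_real_derivative d) (at (x $ i))"
  shows "partial i f x = d"
proof -
  have "((\<lambda>y. F (y $ i)) has_derivative (\<lambda>v. d * v $ i)) (at x)"
    using has_derivative_compose[OF bounded_linear.has_derivative[OF bounded_linear_vec_nth has_derivative_ident]
        assms(4)[unfolded has_field_derivative_def]] .
  then have "partial i (\<lambda>y. F (y $ i)) x = d"
    by (simp add: partial_eqI)
  then show ?thesis
    using partial_cong_open[OF assms(1,2), of f "\<lambda>y. F (y $ i)"] assms(3) by simp
qed

text \<open>This is \<open>h'' = h'\<close> as a first-order system with \<open>k = h'\<close>. The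
  functions \<open>k t * exp (- t)\<close> and \<open>h t - k t\<close> have derivative zero on a
  connected set; their constant values are \<open>B\<close> and \<open>A\<close>.\<close>

lemma exp_ode_solution:
  fixes h k :: "real \<Rightarrow> real"
  assumes "open S" "is_interval S"
    and h: "\<And>t. t \<in> S \<Longrightarrow> (h has_real_derivative k t) (at t)"
    and k: "\<And>t. t \<in> S \<Longrightarrow> (k has_real_derivative k t) (at t)"
  obtains A B where "\<And>t. t \<in> S \<Longrightarrow> h t = A + B * exp t"
proof -
  have S: "connected S"
    using assms(2) is_interval_connected by blast
  have "((\<lambda>t. k t * exp (- t)) has_real_derivative 0) (at t)" if "t \<in> S" for t
    using k[OF that] by (auto intro!: derivative_eq_intros)
  then have "(\<lambda>t. k t * exp (- t)) constant_on S"
    by (rule has_field_derivative_0_imp_constant_on[OF _ S assms(1)])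
  then obtain B where B: "k t * exp (- t) = B" if "t \<in> S" for t
    unfolding constant_on_def by blast
  have "((\<lambda>t. h t - k t) has_real_derivative 0) (at t)" if "t \<in> S" for t
    using h[OF that] k[OF that] by (auto intro!: derivative_eq_intros)
  then have "(\<lambda>t. h t - k t) constant_on S"
    by (rule has_field_derivative_0_imp_constant_on[OF _ S assms(1)])
  then obtain A where A: "h t - k t = A" if "t \<in> S" for t
    unfolding constant_on_def by blast
  have "h t = A + B * exp t" if "t \<in> S" for t
  proof -
    have "k t = B * exp t"
      using B[OF that] by (auto simp: exp_minus field_simps)
    with A[OF that] show ?thesis
      by simp
  qed
  then show thesis
    using that by blast
qed

section \<open>The metric and its orthonormal frame\<close>

lemma diag_metric_eq:
  "diag_metric f1 f2 x u v = u $ 1 * v $ 1 / (f1 x)\<^sup>2 + u $ 2 * v $ 2 / (f2 x)\<^sup>2 + u $ 3 * v $ 3"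
  by (simp add: diag_metric_def tensor_prod_def coord_form_def)

lemma riemannian_metric_diag_metric:
  assumes U: "open U" and f: "smooth_on U f1" "smooth_on U f2"
    and nz: "\<And>x. x \<in> U \<Longrightarrow> f1 x \<noteq> 0" "\<And>x. x \<in> U \<Longrightarrow> f2 x \<noteq> 0"
  shows "riemannian_metric U (diag_metric f1 f2)"
  unfolding riemannian_metric_def
proof (intro conjI ballI allI impI)
  show "bilinear (diag_metric f1 f2 x)" for x
    unfolding bilinear_def diag_metric_eq
    by (auto intro!: linearI simp: field_simps add_divide_distrib)
  show "diag_metric f1 f2 x u v = diag_metric f1 f2 x v u" for x u v
    by (simp add: diag_metric_eq mult.commute)
  show "diag_metric f1 f2 x u u > 0" if "x \<in> U" "u \<noteq> 0" for x u
  proof -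
    have "u $ 1 \<noteq> 0 \<or> u $ 2 \<noteq> 0 \<or> u $ 3 \<noteq> 0"
      using that(2) by (auto simp: vec_eq_iff forall_3)
    moreover have "diag_metric f1 f2 x u u = (u $ 1 / f1 x)\<^sup>2 + (u $ 2 / f2 x)\<^sup>2 + (u $ 3)\<^sup>2"
      by (simp add: diag_metric_eq power2_eq_square)
    ultimately show ?thesis
      using nz[OF that(1)]
      by (smt (verit) divide_eq_0_iff zero_eq_power2 zero_le_power2)
  qed
  show "smooth_on U (\<lambda>x. diag_metric f1 f2 x (axis i 1) (axis j 1))" for i j
    unfolding diag_metric_eq power2_eq_square
    using f nz by (intro smooth_on_intros[OF U]) auto
qed (rule U)

lemma lie_bracket_scaled_axes:
  fixes f h :: "real ^ 'n::finite \<Rightarrow> real"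
  assumes "f differentiable (at x)" "h differentiable (at x)"
  shows "lie_bracket (\<lambda>y. f y *\<^sub>R axis i 1) (\<lambda>y. h y *\<^sub>R axis j 1) x =
    (f x * partial i h x) *\<^sub>R axis j 1 - (h x * partial j f x) *\<^sub>R axis i 1"
  using assms
  by (simp add: lie_bracket_def frechet_derivative_scaleR partial_def
      linear_scale[OF linear_frechet_derivative])

text \<open>The curvature computation is local, so the domain is an arbitrary open set. In the
  second and third coordinates the metric is a warped product with warping function
  \<open>1 / f2\<close>, up to sign.\<close>

locale warped_metric =
  fixes U :: "(real ^ 3) set" and f1 f2 :: "real ^ 3 \<Rightarrow> real" and D :: "3 connection"
  assumes open_dom: "open U" and smooth: "smooth_on U f1" "smooth_on U f2"
    and nonzero: "\<And>x. x \<in> U \<Longrightarrow> f1 x \<noteq> 0" "\<And>x. x \<in> U \<Longrightarrow> f2 x \<noteq> 0"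
    and depends: "depends_only_on U 1 f1" "depends_only_on U 3 f2"
    and levi_civita: "levi_civita_connection U (diag_metric f1 f2) D"
begin

sublocale levi_civita U "diag_metric f1 f2" D
  by (intro levi_civita.intro riemannian_metric_diag_metric open_dom smooth nonzero levi_civita)

abbreviation g where "g \<equiv> diag_metric f1 f2"
abbreviation E where "E \<equiv> diag_frame f1 f2"

text \<open>A common name for the scale factors of the frame, so that brackets and components are
  given by one formula for all indices.\<close>

definition c :: "3 \<Rightarrow> real ^ 3 \<Rightarrow> real" where
  "c k = (if k = 1 then f1 else if k = 2 then f2 else (\<lambda>x. 1))"

definition a :: "real ^ 3 \<Rightarrow> real" where
  "a x = partial 3 f2 x / f2 x"

lemma frame_eq: "E k = (\<lambda>x. c k x *\<^sub>R axis k 1)"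
  using exhaust_3[of k] by (auto simp: diag_frame_def c_def coord_field_def)

lemma smooth_c: "smooth_on U (c k)"
  using smooth by (simp add: c_def smooth_intros)

lemma c_nonzero: "x \<in> U \<Longrightarrow> c k x \<noteq> 0"
  using nonzero by (simp add: c_def)

lemma smooth_frame: "smooth_on U (E k)"
  unfolding frame_eq by (intro smooth_intros smooth_c)

lemma smooth_a: "smooth_on U a"
  unfolding a_def[abs_def] using smooth nonzero by (intro smooth_intros) auto

text \<open>In a bracket of two distinct frame fields each factor is differentiated along the axis
  of the other, hence the off-diagonal derivatives.\<close>

lemma partial_c: "x \<in> U \<Longrightarrow> i \<noteq> j \<Longrightarrow> partial i (c j) x = (if i = 3 \<and> j = 2 then a x * f2 x else 0)"
  using partial_depends_only_on[OF open_dom depends(1), of x i] nonzero(2)[of x]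
    partial_depends_only_on[OF open_dom depends(2), of x i] exhaust_3[of i] exhaust_3[of j]
    smooth[THEN smooth_on_differentiable, of x]
  by (auto simp: c_def a_def)

text \<open>Mixed derivatives commute, so \<open>partial 3 f2\<close> inherits from
  \<open>f2\<close> the vanishing of the derivatives along the other two axes.\<close>

lemma partial_a: "x \<in> U \<Longrightarrow> i \<noteq> 3 \<Longrightarrow> partial i a x = 0"
proof -
  assume x: "x \<in> U" and i: "i \<noteq> 3"
  note diff = smooth_on_differentiable[of U, OF _ x]
  have 0: "partial i f2 y = 0" if "y \<in> U" for y
    using partial_depends_only_on[OF open_dom depends(2) that _ i] smooth(2) smooth_on_differentiable that
    by blast
  have "partial i (partial 3 f2) x = partial 3 (partial i f2) x"
    by (rule partial_commute[OF open_dom smooth(2) x])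
  also have "\<dots> = 0"
    using partial_cong_open[OF open_dom x, of "partial i f2" "\<lambda>_. 0" 3] 0 by simp
  finally have "partial i (\<lambda>y. partial 3 f2 y * inverse (f2 y)) x = 0"
    using 0[OF x] nonzero(2)
    by (simp add: partial_mult[OF diff[OF smooth_on_partial[OF smooth(2)]]
          diff[OF smooth_on_inverse[OF open_dom smooth(2)]]]
        partial_inverse[OF diff[OF smooth(2)] nonzero(2)[OF x]])
  then show ?thesis
    by (simp add: a_def[abs_def] divide_inverse)
qed

text \<open>The factor \<open>c k\<close> of the frame field cancels one of the two in the metric,
  so pairing with \<open>E k\<close> reads off the frame coefficient.\<close>

lemma metric_frame_right: "x \<in> U \<Longrightarrow> g x u (E k x) = u $ k / c k x"
  using exhaust_3[of k] nonzero
  by (auto simp: diag_metric_eq frame_eq c_def axis_def power2_eq_square)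

lemma metric_frame: "x \<in> U \<Longrightarrow> g x (E j x) (E k x) = (if j = k then 1 else 0)"
  using c_nonzero[of x k] by (auto simp: metric_frame_right) (auto simp: frame_eq axis_def)

lemma orthonormal_frame: "orthonormal_frame U g E"
  by (simp add: orthonormal_frame_def smooth_frame metric_frame)

lemma frame_expansion: "x \<in> U \<Longrightarrow> v = (\<Sum>i\<in>UNIV. (v $ i / c i x) *\<^sub>R E i x)"
  using c_nonzero[of x]
  by (simp add: frame_eq basis_expansion[of v, unfolded scalar_mult_eq_scaleR])

section \<open>Connection and curvature in the orthonormal frame\<close>

lemma lie_bracket_frame:
  "x \<in> U \<Longrightarrow> lie_bracket (E i) (E j) x =
    (if i = 2 \<and> j = 3 then - a x else if i = 3 \<and> j = 2 then a x else 0) *\<^sub>R E 2 x"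
  \<comment> \<open>For equal indices the two terms of the bracket formula cancel;
    \<open>partial_c\<close> covers distinct indices.\<close>
  by (cases "i = j") (simp_all add: frame_eq partial_c
      lie_bracket_scaled_axes[OF smooth_on_differentiable[OF smooth_c] smooth_on_differentiable[OF smooth_c]],
      auto simp: c_def)

lemma conn_frame:
  assumes x: "x \<in> U"
  shows "D (E i) (E j) x =
    (if i = 2 \<and> j = 2 then a x *\<^sub>R E 3 x else if i = 2 \<and> j = 3 then - a x *\<^sub>R E 2 x else 0)"
proof -
  \<comment> \<open>Products of frame fields are constant on \<open>U\<close>, so only the bracket
    terms of the Koszul formula survive.\<close>
  have const: "vderiv X (\<lambda>y. g y (E j y) (E k y)) x = 0" for X j k
  proof -
    have "vderiv X (\<lambda>y. g y (E j y) (E k y)) x = vderiv X (\<lambda>y. if j = k then 1 else 0) x"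
      by (rule vderiv_cong[OF x]) (simp add: metric_frame)
    then show ?thesis
      by (simp add: vderiv_def)
  qed
  have lb: "g x (lie_bracket (E i) (E j) x) (E k x) =
      (if k = 2 then if i = 2 \<and> j = 3 then - a x else if i = 3 \<and> j = 2 then a x else 0 else 0)" for i j k
    using x by (simp add: lie_bracket_frame metric_simps metric_frame)
  have coeff: "g x (D (E i) (E j) x) (E k x) =
      (if i = 2 \<and> j = 2 \<and> k = 3 then a x else if i = 2 \<and> j = 3 \<and> k = 2 then - a x else 0)" for k
    using exhaust_3[of i] exhaust_3[of j] exhaust_3[of k]
      koszul[OF smooth_frame smooth_frame smooth_frame x, of i j k]
    by (elim disjE) (simp_all add: const lb)
  have "D (E i) (E j) x = (\<Sum>k\<in>UNIV. g x (D (E i) (E j) x) (E k x) *\<^sub>R E k x)"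
    using frame_expansion[OF x, of "D (E i) (E j) x"] by (simp add: metric_frame_right[OF x])
  also have "\<dots> = (if i = 2 \<and> j = 2 then a x *\<^sub>R E 3 x
      else if i = 2 \<and> j = 3 then - a x *\<^sub>R E 2 x else 0)"
    by (auto simp: coeff sum_3)
  finally show ?thesis .
qed

lemma vderiv_frame_a: "x \<in> U \<Longrightarrow> vderiv (E k) a x = (if k = 3 then partial 3 a x else 0)"
  using partial_a[of x k] smooth_on_differentiable[OF smooth_a, of x]
    exhaust_3[of k]
  by (auto simp: vderiv_partial frame_eq axis_def c_def sum_3)

lemma conn_conn_frame:
  assumes x: "x \<in> U"
  shows "D (E k) (D (E i) (E j)) x =
    (if i = 2 \<and> j = 2 \<and> k = 3 then partial 3 a x *\<^sub>R E 3 x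
     else if i = 2 \<and> j = 2 \<and> k = 2 then - (a x * a x) *\<^sub>R E 2 x
     else if i = 2 \<and> j = 3 \<and> k = 3 then - partial 3 a x *\<^sub>R E 2 x
     else if i = 2 \<and> j = 3 \<and> k = 2 then - (a x * a x) *\<^sub>R E 3 x else 0)"
proof -
  have scaled: "D (E k) (\<lambda>y. a y *\<^sub>R E l y) x = vderiv (E k) a x *\<^sub>R E l x + a x *\<^sub>R D (E k) (E l) x" for l
    by (rule conn_leibniz[OF smooth_a smooth_frame smooth_frame x])
  \<comment> \<open>Every \<open>D (E i) (E j)\<close> is \<open>?b\<close> times \<open>a\<close>
    times \<open>E ?l\<close> with a constant \<open>?b\<close>, so one Leibniz computation serves
    all cases. Where \<open>?b\<close> is \<open>0\<close>, the value of \<open>?l\<close> is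
    arbitrary.\<close>
  let ?b = "if i = 2 \<and> j = 2 then 1 else if i = 2 \<and> j = 3 then - 1 else 0"
  let ?l = "if j = 2 then 3 else 2"
  have "D (E k) (D (E i) (E j)) x = D (E k) (\<lambda>y. ?b *\<^sub>R a y *\<^sub>R E ?l y) x"
    by (intro conn_cong_right smooth_conn smooth_intros smooth_a smooth_frame x)
      (simp add: conn_frame)
  also have "\<dots> = ?b *\<^sub>R D (E k) (\<lambda>y. a y *\<^sub>R E ?l y) x"
    using conn_leibniz[OF smooth_on_const[OF open_dom, of ?b] smooth_frame
        smooth_on_scaleR[OF open_dom smooth_a smooth_frame] x, of k ?l]
    by (simp add: vderiv_def)
  finally show ?thesis
    using exhaust_3[of k] by (auto simp: scaled vderiv_frame_a x conn_frame)
qed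

lemma conn_lie_bracket_frame:
  assumes x: "x \<in> U" and Z: "smooth_on U Z"
  shows "D (lie_bracket (E k) (E i)) Z x =
    (if k = 2 \<and> i = 3 then - a x else if k = 3 \<and> i = 2 then a x else 0) *\<^sub>R D (E 2) Z x"
proof -
  let ?b = "if k = 2 \<and> i = 3 then - 1 else if k = 3 \<and> i = 2 then 1 else 0"
  have "D (lie_bracket (E k) (E i)) Z x = D (\<lambda>y. (?b * a y) *\<^sub>R E 2 y) Z x"
    by (intro conn_cong_left smooth_intros smooth_a smooth_frame x Z) (simp add: lie_bracket_frame)
  also have "\<dots> = (?b * a x) *\<^sub>R D (E 2) Z x"
    by (intro conn_scale_left smooth_intros smooth_a smooth_frame x Z)
  finally show ?thesis
    by simp
qed

text \<open>\<open>E 1\<close> is parallel, so only the plane of \<open>E 2\<close> and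
  \<open>E 3\<close> is curved. The diagonal value is the Gaussian curvature
  \<open>- h'' / h\<close> of that surface metric, with \<open>h = 1 / f2\<close> and derivatives
  along the third axis.\<close>

lemma ricci_frame:
  assumes x: "x \<in> U"
  shows "ricci_tensor g D E (E i) (E j) x = (if i = j \<and> i \<noteq> 1 then partial 3 a x - a x * a x else 0)"
  using exhaust_3[of i] exhaust_3[of j] x
  by (elim disjE) (simp_all add: ricci_tensor_def sum_3 riemann_curvature_def conn_conn_frame
      conn_lie_bracket_frame smooth_frame conn_frame metric_simps metric_frame)

lemma ricci_eq:
  assumes "smooth_on U Y" "smooth_on U Z" "x \<in> U"
  shows "ricci_tensor g D E Y Z x = (partial 3 a x - a x * a x) *
    (Y x $ 2 / f2 x * (Z x $ 2 / f2 x) + Y x $ 3 * Z x $ 3)"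
proof -
  have "ricci_tensor g D E Y Z x = (\<Sum>i\<in>UNIV. \<Sum>j\<in>UNIV.
      Y x $ i / c i x * (Z x $ j / c j x) * ricci_tensor g D E (E i) (E j) x)"
    using assms c_nonzero
    by (intro ricci_tensor_expand smooth_frame frame_expansion smooth_intros smooth_c)
  then show ?thesis
    using assms(3) by (simp add: ricci_frame sum_3 c_def algebra_simps)
qed

lemma lie_derivative_eq:
  assumes "smooth_on U Y" "smooth_on U Z" "x \<in> U"
  shows "lie_derivative_metric (coord_field 3) g Y Z x = - 2 * a x * (Y x $ 2 / f2 x * (Z x $ 2 / f2 x))"
proof -
  \<comment> \<open>As \<open>V\<close> is a frame field, its covariant derivative along
    \<open>Y\<close> follows by expanding \<open>Y\<close> in the frame; only the \<open>E 2\<close>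
    component contributes.\<close>
  have E3: "coord_field 3 = E 3"
    by (simp add: diag_frame_def)
  have conn: "D Y (E 3) x = (- a x * (Y x $ 2 / f2 x)) *\<^sub>R E 2 x" if "smooth_on U Y" for Y
  proof -
    have "D Y (E 3) x = D (\<lambda>y. \<Sum>i\<in>UNIV. (Y y $ i / c i y) *\<^sub>R E i y) (E 3) x"
      using that assms(3) c_nonzero
      by (intro conn_cong_left smooth_frame frame_expansion smooth_intros smooth_c)
    also have "\<dots> = (\<Sum>i\<in>UNIV. (Y x $ i / c i x) *\<^sub>R D (E i) (E 3) x)"
      using that assms(3) c_nonzero by (intro conn_sum_left smooth_frame smooth_intros smooth_c)
    finally show ?thesis
      using assms(3) by (simp add: conn_frame sum_3 c_def)
  qed
  have "g x (E 2 x) u = u $ 2 / f2 x" for u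
    using assms(3) metric_sym[OF assms(3), of u] metric_frame_right[OF assms(3), of u 2] by (simp add: c_def)
  then show ?thesis
    using assms
    by (simp add: E3 lie_derivative_metric_eq smooth_frame conn metric_simps metric_frame_right c_def)
qed

section \<open>The soliton equation as a system for \<open>a\<close>\<close>

lemma soliton_iff:
  assumes "smooth_on U lam" "smooth_on U mu" "\<exists>x\<in>U. mu x \<noteq> 0"
  shows "almost_eta_ricci_soliton U g D E (coord_field 3) (coord_form 3) lam mu \<longleftrightarrow>
    (\<forall>x\<in>U. lam x = 0 \<and> mu x = - a x \<and> partial 3 a x = a x * a x + a x)"
    (is "?L \<longleftrightarrow> ?R")
proof -
  let ?eq = "\<lambda>Y Z x. 1 / 2 * lie_derivative_metric (coord_field 3) g Y Z x + ricci_tensor g D E Y Z x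
    + lam x * g x (Y x) (Z x) + mu x * tensor_prod (coord_form 3) (coord_form 3) x (Y x) (Z x)"
  \<comment> \<open>In frame components the soliton tensor is diagonal; the three coefficients
    displayed here are its diagonal entries.\<close>
  have eq: "?eq Y Z x = lam x * (Y x $ 1 / f1 x * (Z x $ 1 / f1 x)) +
      (partial 3 a x - a x * a x - a x + lam x) * (Y x $ 2 / f2 x * (Z x $ 2 / f2 x)) +
      (partial 3 a x - a x * a x + lam x + mu x) * (Y x $ 3 * Z x $ 3)"
    if "smooth_on U Y" "smooth_on U Z" "x \<in> U" for Y Z x
    by (simp add: ricci_eq lie_derivative_eq that diag_metric_eq tensor_prod_def coord_form_def
        power2_eq_square algebra_simps add_divide_distrib diff_divide_distrib)
  have "smooth_one_form U (coord_form 3)"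
    by (auto simp: smooth_one_form_def coord_form_def intro!: linearI smooth_intros)
  moreover have "smooth_on U (coord_field 3)"
    unfolding coord_field_def by (intro smooth_intros)
  ultimately have "?L \<longleftrightarrow> (\<forall>Y Z. smooth_on U Y \<longrightarrow> smooth_on U Z \<longrightarrow> (\<forall>x\<in>U. ?eq Y Z x = 0))"
    using assms metric connection orthonormal_frame by (simp add: almost_eta_ricci_soliton_def)
  also have "\<dots> \<longleftrightarrow> ?R"
  proof
    assume *: "\<forall>Y Z. smooth_on U Y \<longrightarrow> smooth_on U Z \<longrightarrow> (\<forall>x\<in>U. ?eq Y Z x = 0)"
    show ?R
    proof
      fix x
      assume x: "x \<in> U"
      \<comment> \<open>Testing on \<open>E k\<close> isolates the k-th coefficient. The first gives
        \<open>lam x = 0\<close>, the second the equation for \<open>a\<close>, and its difference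
        from the third gives \<open>mu x = - a x\<close>.\<close>
      have "?eq (E k) (E k) x = 0" for k
        using * smooth_frame x by blast
      note frame = this[unfolded eq[OF smooth_frame smooth_frame x]]
      from frame[of 1] frame[of 2] frame[of 3] have "lam x = 0" "partial 3 a x - a x * a x - a x + lam x = 0"
        "partial 3 a x - a x * a x + lam x + mu x = 0"
        using nonzero[OF x] by (simp_all add: frame_eq c_def axis_def)
      then show "lam x = 0 \<and> mu x = - a x \<and> partial 3 a x = a x * a x + a x"
        by simp
    qed
  next
    assume R: ?R
    show "\<forall>Y Z. smooth_on U Y \<longrightarrow> smooth_on U Z \<longrightarrow> (\<forall>x\<in>U. ?eq Y Z x = 0)"
    proof (intro allI impI ballI)
      show "?eq Y Z x = 0" if "smooth_on U Y" "smooth_on U Z" "x \<in> U" for Y Z x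
        unfolding eq[OF that] using R that(3) by simp
    qed
  qed
  finally show ?thesis .
qed

text \<open>With \<open>h = 1 / f2\<close> one has \<open>a = - h' / h\<close>; this evaluates it
  for \<open>h = A + B * exp t\<close> and checks the differential equation.\<close>

lemma a_eq:
  assumes f2: "\<And>x. x \<in> U \<Longrightarrow> f2 x = 1 / (A + B * exp (x $ 3))" and x: "x \<in> U"
  shows "a x = - (B * exp (x $ 3)) / (A + B * exp (x $ 3))"
    and "partial 3 a x = a x * a x + a x"
proof -
  \<comment> \<open>A zero denominator would give \<open>f2 y = 0\<close>, since division by zero
    yields \<open>0\<close>.\<close>
  have nz: "A + B * exp (y $ 3) \<noteq> 0" if "y \<in> U" for y
    using f2[OF that] nonzero(2)[OF that] by auto
  \<comment> \<open>Established on all of \<open>U\<close>, because the formula is differentiated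
    again below.\<close>
  have a: "a y = - (B * exp (y $ 3)) / (A + B * exp (y $ 3))" if "y \<in> U" for y
  proof -
    have "((\<lambda>t. 1 / (A + B * exp t)) has_real_derivative
        - (B * exp (y $ 3)) / (A + B * exp (y $ 3))\<^sup>2) (at (y $ 3))"
      using nz[OF that] by (auto intro!: derivative_eq_intros simp: power2_eq_square)
    from partial_coordinate_function[OF open_dom that f2 this] show ?thesis
      using nz[OF that] by (simp add: a_def f2[OF that] power2_eq_square)
  qed
  show "a x = - (B * exp (x $ 3)) / (A + B * exp (x $ 3))"
    by (rule a[OF x])
  have "((\<lambda>t. - (B * exp t) / (A + B * exp t)) has_real_derivative
      - (A * B * exp (x $ 3)) / (A + B * exp (x $ 3))\<^sup>2) (at (x $ 3))"
    using nz[OF x] by (auto intro!: derivative_eq_intros simp: power2_eq_square algebra_simps)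
  from partial_coordinate_function[OF open_dom x a this] show "partial 3 a x = a x * a x + a x"
    using nz[OF x] by (simp add: a[OF x] power2_eq_square divide_simps) (simp add: algebra_simps)
qed

end

section \<open>Classification\<close>

lemma open_open_box: "open I1 \<Longrightarrow> open I2 \<Longrightarrow> open I3 \<Longrightarrow> open (open_box I1 I2 I3)"
  unfolding open_box_def
  by (intro open_Collect_conj open_vimage[where f = "\<lambda>x. x $ _", unfolded vimage_def] continuous_intros)

text \<open>The parameters correspond through \<open>c0 = 1 / B\<close> if \<open>A = 0\<close>, and
  through \<open>c1 = 1 / A\<close>, \<open>c2 = B / A\<close> otherwise.\<close>

lemma reciprocal_exponential_family_iff:
  fixes f2 lam mu :: "real ^ 3 \<Rightarrow> real"
  assumes "\<exists>x\<in>open_box I1 I2 I3. mu x \<noteq> 0" "\<forall>x\<in>open_box I1 I2 I3. f2 x \<noteq> 0"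
  shows "(\<exists>A B. \<forall>x\<in>open_box I1 I2 I3. f2 x = 1 / (A + B * exp (x $ 3)) \<and> lam x = 0 \<and>
      mu x = B * exp (x $ 3) / (A + B * exp (x $ 3))) \<longleftrightarrow>
    (\<exists>c0. c0 \<noteq> 0 \<and> (\<forall>x\<in>open_box I1 I2 I3. f2 x = c0 * exp (- (x $ 3)) \<and> lam x = 0 \<and> mu x = 1)) \<or>
    (\<exists>c1 c2. c1 \<noteq> 0 \<and> c2 \<noteq> 0 \<and> (\<forall>t\<in>I3. c2 \<noteq> - exp (- t)) \<and>
      (\<forall>x\<in>open_box I1 I2 I3. f2 x = c1 / (c2 * exp (x $ 3) + 1) \<and> lam x = 0 \<and>
        mu x = c2 * exp (x $ 3) / (c2 * exp (x $ 3) + 1)))"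
    (is "?L \<longleftrightarrow> ?R1 \<or> ?R2")
proof
  obtain p where p: "p \<in> open_box I1 I2 I3" "mu p \<noteq> 0"
    using assms(1) by blast
  assume ?L
  then obtain A B where *: "\<And>x. x \<in> open_box I1 I2 I3 \<Longrightarrow> f2 x = 1 / (A + B * exp (x $ 3)) \<and> lam x = 0 \<and>
      mu x = B * exp (x $ 3) / (A + B * exp (x $ 3))"
    by blast
  \<comment> \<open>If \<open>B\<close> were \<open>0\<close>, then \<open>mu\<close> would vanish
    at \<open>p\<close>.\<close>
  have B: "B \<noteq> 0"
    using *[OF p(1)] p(2) by auto
  show "?R1 \<or> ?R2"
  proof (cases "A = 0")
    case True
    have ?R1
      using B * True by (intro exI[of _ "1 / B"]) (simp add: exp_minus divide_simps)
    then show ?thesis ..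
  next
    case False
    \<comment> \<open>Every \<open>t\<close> in \<open>I3\<close> is the third coordinate of a point
      of the box: replace that coordinate of \<open>p\<close>. A vanishing denominator would make
      \<open>f2\<close> zero there.\<close>
    have nz: "A + B * exp t \<noteq> 0" if "t \<in> I3" for t
    proof -
      have "(\<chi> i. if i = 3 then t else p $ i) \<in> open_box I1 I2 I3"
        using p(1) that by (simp add: open_box_def)
      from *[OF this] assms(2) this show ?thesis
        by fastforce
    qed
    have ?R2
    proof (rule exI[of _ "1 / A"], rule exI[of _ "B / A"], intro conjI ballI)
      show "1 / A \<noteq> 0" "B / A \<noteq> 0"
        using False B by auto
      show "B / A \<noteq> - exp (- t)" if "t \<in> I3" for t
        using nz[OF that] False by (auto simp: exp_minus field_simps)
    next
      fix x
      assume x: "x \<in> open_box I1 I2 I3"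
      have eq: "B / A * exp (x $ 3) + 1 = (A + B * exp (x $ 3)) / A"
        using False by (simp add: field_simps)
      show "f2 x = 1 / A / (B / A * exp (x $ 3) + 1)" "lam x = 0"
        "mu x = B / A * exp (x $ 3) / (B / A * exp (x $ 3) + 1)"
        unfolding eq using *[OF x] False by simp_all
    qed
    then show ?thesis ..
  qed
next
  assume "?R1 \<or> ?R2"
  then show ?L
  proof
    assume ?R1
    then obtain c0 where "c0 \<noteq> 0" "\<forall>x\<in>open_box I1 I2 I3. f2 x = c0 * exp (- (x $ 3)) \<and> lam x = 0 \<and> mu x = 1"
      by blast
    then show ?L
      by - (rule exI[of _ 0], rule exI[of _ "1 / c0"], simp add: exp_minus divide_simps)
  next
    assume ?R2
    then obtain c1 c2 where c: "c1 \<noteq> 0" "\<forall>x\<in>open_box I1 I2 I3. f2 x = c1 / (c2 * exp (x $ 3) + 1) \<and>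
        lam x = 0 \<and> mu x = c2 * exp (x $ 3) / (c2 * exp (x $ 3) + 1)"
      by blast
    have "1 / c1 + c2 / c1 * exp t = (c2 * exp t + 1) / c1" for t
      by (simp add: add_divide_distrib)
    then show ?L
      using c by - (rule exI[of _ "1 / c1"], rule exI[of _ "c2 / c1"], simp)
  qed
qed

theorem theorem3p26:
  fixes I1 I2 I3 :: "real set" and I :: "(real ^ 3) set"
    and f1 f2 lam mu :: "real ^ 3 \<Rightarrow> real"
    and D :: "3 connection"
  assumes "open I1" "is_interval I1" "open I2" "is_interval I2" "open I3" "is_interval I3"
    and I_eq: "I = open_box I1 I2 I3"
    and "smooth_on I f1" "\<forall>x\<in>I. f1 x \<noteq> 0"
    and "smooth_on I f2" "\<forall>x\<in>I. f2 x \<noteq> 0"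
    and "levi_civita_connection I (diag_metric f1 f2) D"
    and "smooth_on I lam" "smooth_on I mu" "\<exists>x\<in>I. mu x \<noteq> 0"
    and "depends_only_on I 1 f1" "depends_only_on I 3 f2"
  shows "(almost_eta_ricci_soliton I (diag_metric f1 f2) D (diag_frame f1 f2)
            (coord_field 3) (coord_form 3) lam mu \<longleftrightarrow>
          (\<exists>c0. c0 \<noteq> 0 \<and>
            (\<forall>x\<in>I. f2 x = c0 * exp (- (x $ 3)) \<and> lam x = 0 \<and> mu x = 1)) \<or>
          (\<exists>c1 c2. c1 \<noteq> 0 \<and> c2 \<noteq> 0 \<and> (\<forall>t\<in>I3. c2 \<noteq> - exp (- t)) \<and>
            (\<forall>x\<in>I. f2 x = c1 / (c2 * exp (x $ 3) + 1) \<and> lam x = 0 \<and>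
              mu x = c2 * exp (x $ 3) / (c2 * exp (x $ 3) + 1))))
       \<and> (I3 = UNIV \<longrightarrow>
          (\<forall>c1 c2. c1 \<noteq> 0 \<and> c2 \<noteq> 0 \<and> (\<forall>t\<in>I3. c2 \<noteq> - exp (- t)) \<and>
            (\<forall>x\<in>I. f2 x = c1 / (c2 * exp (x $ 3) + 1) \<and> lam x = 0 \<and>
              mu x = c2 * exp (x $ 3) / (c2 * exp (x $ 3) + 1)) \<longrightarrow> c2 > 0))"
proof -
  have I: "open I"
    unfolding I_eq by (intro open_open_box assms)
  interpret warped_metric I f1 f2 D
    using assms I by unfold_locales auto
  have soliton: "almost_eta_ricci_soliton I (diag_metric f1 f2) D (diag_frame f1 f2)
      (coord_field 3) (coord_form 3) lam mu \<longleftrightarrow>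
    (\<forall>x\<in>I. lam x = 0 \<and> mu x = - a x \<and> partial 3 a x = a x * a x + a x)"
    by (rule soliton_iff) fact+
  have solutions: "(\<forall>x\<in>I. lam x = 0 \<and> mu x = - a x \<and> partial 3 a x = a x * a x + a x) \<longleftrightarrow>
    (\<exists>A B. \<forall>x\<in>I. f2 x = 1 / (A + B * exp (x $ 3)) \<and> lam x = 0 \<and>
      mu x = B * exp (x $ 3) / (A + B * exp (x $ 3)))"
    (is "?L \<longleftrightarrow> ?R")
  proof
    assume L: ?L
    obtain p where p: "p \<in> I"
      using \<open>\<exists>x\<in>I. mu x \<noteq> 0\<close> by blast
    \<comment> \<open>Projecting \<open>p\<close> to height zero makes the line \<open>?l\<close>
      parametrised by its own third coordinate. The point \<open>q\<close> itself may lie outside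
      \<open>I\<close>.\<close>
    define q where "q = p - (p $ 3) *\<^sub>R axis 3 1"
    let ?l = "\<lambda>t. q + t *\<^sub>R axis 3 1"
    have l: "?l t \<in> I" if "t \<in> I3" for t
      using p that by (simp add: q_def I_eq open_box_def axis_def)
    have along: "((\<lambda>t. h (?l t)) has_real_derivative partial 3 h (?l t)) (at t)"
      if "smooth_on I h" "t \<in> I3" for h t
      using has_real_derivative_along_axis smooth_on_differentiable that l by blast
    obtain A B where AB: "\<And>t. t \<in> I3 \<Longrightarrow> 1 / f2 (?l t) = A + B * exp t"
    proof (rule exp_ode_solution[OF \<open>open I3\<close> \<open>is_interval I3\<close>])
      fix t
      assume t: "t \<in> I3"
      have nz: "f2 (?l t) \<noteq> 0"
        using l[OF t] nonzero by blast
      have f2': "partial 3 f2 (?l t) = a (?l t) * f2 (?l t)"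
        using nz by (simp add: a_def)
      \<comment> \<open>With \<open>h = 1 / f2\<close> along the line, \<open>h' = - a * h\<close>;
        this is the function \<open>k\<close> of the linear system. The equation for
        \<open>a\<close> then gives \<open>k' = k\<close>.\<close>
      show "((\<lambda>t. 1 / f2 (?l t)) has_real_derivative - a (?l t) / f2 (?l t)) (at t)"
        using nz by (auto intro!: derivative_eq_intros along[OF smooth(2) t] simp: f2')
      have a': "partial 3 a (?l t) = a (?l t) * a (?l t) + a (?l t)"
        using L l[OF t] by blast
      show "((\<lambda>t. - a (?l t) / f2 (?l t)) has_real_derivative - a (?l t) / f2 (?l t)) (at t)"
        using nz by (auto intro!: derivative_eq_intros along[OF smooth(2) t] along[OF smooth_a t]
            simp: f2' a' divide_simps) (simp add: algebra_simps)
    qed (use that in blast)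
    \<comment> \<open>The formula on one line extends to all of \<open>I\<close>, since
      \<open>f2\<close> depends only on the third coordinate.\<close>
    have f2: "f2 x = 1 / (A + B * exp (x $ 3))" if "x \<in> I" for x
    proof -
      have "x $ 3 \<in> I3" "?l (x $ 3) $ 3 = x $ 3"
        using that by (auto simp: I_eq open_box_def q_def axis_def)
      moreover from this have "f2 x = f2 (?l (x $ 3))"
        using depends(2) l that unfolding depends_only_on_def by metis
      ultimately show ?thesis
        using AB by (metis div_by_1 divide_divide_eq_right mult_1)
    qed
    with L show ?R
      by (intro exI[of _ A] exI[of _ B]) (simp add: a_eq(1)[OF f2])
  next
    assume ?R
    then show ?L
      using a_eq by (metis minus_divide_left minus_minus)
  qed
  note classification = trans[OF trans[OF soliton solutions]
      reciprocal_exponential_family_iff[of I1 I2 I3 mu f2 lam, folded I_eq,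
        OF \<open>\<exists>x\<in>I. mu x \<noteq> 0\<close> \<open>\<forall>x\<in>I. f2 x \<noteq> 0\<close>]]
  have pos: "c2 > 0" if "I3 = UNIV" "c2 \<noteq> 0" "\<forall>t\<in>I3. c2 \<noteq> - exp (- t)" for c2 :: real
  proof (rule ccontr)
    assume "\<not> c2 > 0"
    \<comment> \<open>For negative \<open>c2\<close> the excluded equality occurs at
      \<open>t = - ln (- c2)\<close>, which lies in \<open>I3\<close> when \<open>I3\<close> is the
      whole line.\<close>
    then have "- exp (- (- ln (- c2))) = c2"
      using that(2) by simp
    then show False
      using that(1,3) by (metis UNIV_I)
  qed
  show ?thesis
    by (rule conjI[OF classification]) (intro impI allI, elim conjE, rule pos)
qed

end
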